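(* Let $S=K[x_1,\dots,x_n]$ with $K$ an $F$-finite field of prime characteristic $p$, $I\subseteq S$ a squarefree monomial ideal, $R=S/I$, and let $\mathfrak p_1,\dots,\mathfrak p_l$ be the minimal primes of $I$ (each generated by variables). Let $\mathfrak a, J$ be ideals of $R$ with $\mathfrak a\subseteq\sqrt J$ and $J$ a monomial ideal; denote also by $\mathfrak a,J$ their preimages in $S$. Then $$c^J_R(\mathfrak a)=\max_{1\le i\le l} c^{JS/\mathfrak p_i}_{S/\mathfrak p_i}(\mathfrak aS/\mathfrak p_i).$$ In particular $c^J_R(\mathfrak a)\in\mathbb Q$.
   Context: For a ring $A$ of characteristic $p$ and ideals $\mathfrak a,J$ with $\mathfrak a\subseteq\sqrt J$, $\nu^J_{\mathfrak a}(p^e)=\max\{m\in\mathbb N\mid \mathfrak a^m\not\subseteq J^{[p^e]}\}$, where $J^{[p^e]}$ is the ideal generated by $p^e$-th powers of elements of $J$; the $F$-threshold is $c^J_A(\mathfrak a)=\lim_{e\to\infty}\nu^J_{\mathfrak a}(p^e)/p^e$ (this limit exists). A monomial ideal of $R$ is one generated by images of monomials. *)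

theory Defs
  imports Complex_Main "HOL-Library.Poly_Mapping" "HOL-Computational_Algebra.Primes"
begin

definition is_ideal :: "'a::comm_ring_1 set \<Rightarrow> bool" where
  "is_ideal I \<longleftrightarrow> 0 \<in> I \<and> (\<forall>x\<in>I. \<forall>y\<in>I. x + y \<in> I) \<and> (\<forall>r. \<forall>x\<in>I. r * x \<in> I)"

definition ideal_gen :: "'a::comm_ring_1 set \<Rightarrow> 'a set" where
  "ideal_gen G = \<Inter>{I. is_ideal I \<and> G \<subseteq> I}"

definition prime_ideal :: "'a::comm_ring_1 set \<Rightarrow> bool" where
  "prime_ideal P \<longleftrightarrow> is_ideal P \<and> P \<noteq> UNIV \<and> (\<forall>x y. x * y \<in> P \<longrightarrow> x \<in> P \<or> y \<in> P)"

definition minimal_primes :: "'a::comm_ring_1 set \<Rightarrow> 'a set set" where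
  "minimal_primes I = {P. prime_ideal P \<and> I \<subseteq> P \<and>
      (\<forall>Q. prime_ideal Q \<and> I \<subseteq> Q \<and> Q \<subseteq> P \<longrightarrow> Q = P)}"

definition ideal_radical :: "'a::comm_ring_1 set \<Rightarrow> 'a set" where
  "ideal_radical J = {x. \<exists>n. x ^ n \<in> J}"

fun ideal_pow :: "'a::comm_ring_1 set \<Rightarrow> nat \<Rightarrow> 'a set" where
  "ideal_pow a 0 = UNIV"
| "ideal_pow a (Suc m) = ideal_gen {x * y | x y. x \<in> a \<and> y \<in> ideal_pow a m}"

definition frob_pow :: "'a::comm_ring_1 set \<Rightarrow> nat \<Rightarrow> 'a set" where
  "frob_pow J q = ideal_gen ((\<lambda>x. x ^ q) ` J)"

(* nu^J_a(q) computed in the quotient ring A/I, expressed through preimages in A: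
   (a A/I)^m \<subseteq> (J A/I)^[q]  iff  a^m \<subseteq> J^[q] + I *)
definition nu_quot :: "'a::comm_ring_1 set \<Rightarrow> 'a set \<Rightarrow> 'a set \<Rightarrow> nat \<Rightarrow> nat" where
  "nu_quot I a J q = Sup {m. \<not> (ideal_pow a m \<subseteq> ideal_gen (frob_pow J q \<union> I))}"

definition F_threshold_quot :: "nat \<Rightarrow> 'a::comm_ring_1 set \<Rightarrow> 'a set \<Rightarrow> 'a set \<Rightarrow> real" where
  "F_threshold_quot p I a J = lim (\<lambda>e. real (nu_quot I a J (p ^ e)) / real (p ^ e))"

definition F_finite :: "'k::field itself \<Rightarrow> bool" where
  "F_finite _ \<longleftrightarrow> (\<exists>B::'k set. finite B \<and>
      (\<forall>x::'k. \<exists>c. x = (\<Sum>b\<in>B. c b ^ CHAR('k) * b)))"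

definition monomial_poly :: "('v \<Rightarrow>\<^sub>0 nat) \<Rightarrow> (('v \<Rightarrow>\<^sub>0 nat) \<Rightarrow>\<^sub>0 'k::comm_ring_1)" where
  "monomial_poly \<alpha> = Poly_Mapping.single \<alpha> 1"

definition monomial_ideal :: "(('v \<Rightarrow>\<^sub>0 nat) \<Rightarrow>\<^sub>0 'k::comm_ring_1) set \<Rightarrow> bool" where
  "monomial_ideal I \<longleftrightarrow> (\<exists>G. G \<subseteq> range monomial_poly \<and> I = ideal_gen G)"

definition squarefree_monomial_ideal :: "(('v \<Rightarrow>\<^sub>0 nat) \<Rightarrow>\<^sub>0 'k::comm_ring_1) set \<Rightarrow> bool" where
  "squarefree_monomial_ideal I \<longleftrightarrow>
     (\<exists>G. G \<subseteq> monomial_poly ` {\<alpha>. \<forall>v. Poly_Mapping.lookup \<alpha> v \<le> 1} \<and> I = ideal_gen G)"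

end

theory Submission
  imports Defs
begin

text \<open>
  All ideals in sight except \<open>\<aa>\<close> are monomial, and monomial ideals form a distributive lattice,
  so \<open>J\<^bsup>[q]\<^esup> + I\<close> is the intersection of the \<open>J\<^bsup>[q]\<^esup> + P\<close> over the minimal primes \<open>P\<close> of \<open>I\<close>.
  Hence \<open>\<nu>\<close> of the quotient is the maximum of the \<open>\<nu>\<close> of the components, and setting the variables
  in \<open>P\<close> to zero turns each component into a threshold \<open>c\<^sup>L(\<aa>)\<close> in a polynomial ring.

  There \<open>\<nu>(q)/q\<close> is bounded, and it increases because \<open>S\<close> is free over \<open>S\<^sup>q\<close>: an element lies in
  \<open>L\<^bsup>[q]\<^esup>\<close> iff all its coordinates lie in \<open>L\<close>. For rationality, \<open>p c\<^sup>L(\<aa>)\<close> is the threshold of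
  \<open>L\<^bsup>[p]\<^esup>\<close>; if \<open>c\<^sup>L(\<aa>)\<close> exceeds the number of generators of \<open>\<aa>\<close> by more than one, then \<open>c\<^sup>L(\<aa>) - 1\<close> is
  the threshold of \<open>L : \<aa>\<close>, since \<open>\<aa>\<^sup>m = \<aa>\<^bsup>[q]\<^esup> \<aa>\<^bsup>m-q\<^esup>\<close> for large \<open>m\<close>; and only finitely many
  thresholds lie below any bound, since distinct thresholds yield strictly decreasing subspaces of
  the polynomials of bounded degree. So two of the numbers \<open>p\<^sup>e c\<^sup>L(\<aa>)\<close> agree modulo the integers.
\<close>

section \<open>Ideals\<close>

lemma is_idealI:
  assumes "0 \<in> I" "\<And>x y. x \<in> I \<Longrightarrow> y \<in> I \<Longrightarrow> x + y \<in> I" "\<And>r x. x \<in> I \<Longrightarrow> r * x \<in> I"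
  shows "is_ideal I"
  using assms by (simp add: is_ideal_def)

lemma ideal_zero: "is_ideal I \<Longrightarrow> 0 \<in> I"
  and ideal_add: "is_ideal I \<Longrightarrow> x \<in> I \<Longrightarrow> y \<in> I \<Longrightarrow> x + y \<in> I"
  and ideal_mult_left: "is_ideal I \<Longrightarrow> x \<in> I \<Longrightarrow> r * x \<in> I"
  by (simp_all add: is_ideal_def)

lemma ideal_mult_right: "is_ideal I \<Longrightarrow> x \<in> I \<Longrightarrow> x * r \<in> I"
  by (metis ideal_mult_left mult.commute)

lemma ideal_diff: "is_ideal I \<Longrightarrow> x \<in> I \<Longrightarrow> y \<in> I \<Longrightarrow> x - y \<in> I"
  using ideal_add[of I x "- 1 * y"] ideal_mult_left[of I y "- 1"] by simp

lemma ideal_sum: "is_ideal I \<Longrightarrow> (\<And>i. i \<in> X \<Longrightarrow> f i \<in> I) \<Longrightarrow> sum f X \<in> I"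
  by (induction X rule: infinite_finite_induct) (auto simp: ideal_zero ideal_add)

lemma is_ideal_UNIV [simp]: "is_ideal UNIV"
  by (simp add: is_ideal_def)

lemma is_ideal_ideal_gen [simp]: "is_ideal (ideal_gen G)"
  by (auto simp: is_ideal_def ideal_gen_def)

lemma ideal_gen_superset: "G \<subseteq> ideal_gen G"
  by (auto simp: ideal_gen_def)

lemma ideal_gen_base: "x \<in> G \<Longrightarrow> x \<in> ideal_gen G"
  using ideal_gen_superset by blast

lemma ideal_gen_subset_iff: "is_ideal I \<Longrightarrow> ideal_gen G \<subseteq> I \<longleftrightarrow> G \<subseteq> I"
  by (auto simp: ideal_gen_def)

lemma ideal_gen_mono: "G \<subseteq> H \<Longrightarrow> ideal_gen G \<subseteq> ideal_gen H"
  by (auto simp: ideal_gen_def)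

lemma ideal_gen_subset_ideal_genI: "G \<subseteq> ideal_gen H \<Longrightarrow> ideal_gen G \<subseteq> ideal_gen H"
  by (simp add: ideal_gen_subset_iff)

lemma is_ideal_vimage:
  assumes "is_ideal I" "h 0 = 0" "\<And>x y. h (x + y) = h x + h y" "\<And>x y. h (x * y) = h x * h y"
  shows "is_ideal {x. h x \<in> I}"
  using assms by (auto simp: is_ideal_def)

text \<open>For fixed \<open>x\<close> the elements \<open>y\<close> with \<open>x * y\<close> in
  the target form an ideal, and likewise in the other factor, so containment can be tested on
  generators, one factor at a time.\<close>

lemma ideal_gen_products:
  "ideal_gen {x * y | x y. x \<in> ideal_gen F \<and> y \<in> ideal_gen G} = ideal_gen {x * y | x y. x \<in> F \<and> y \<in> G}"
    (is "?L = ?R")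
proof
  have 1: "ideal_gen G \<subseteq> {y. x * y \<in> ?R}" if "x \<in> F" for x
    by (subst ideal_gen_subset_iff)
       (use that in \<open>auto simp: ideal_gen_base ideal_zero distrib_left ideal_add mult.left_commute
          ideal_mult_left intro!: is_idealI intro: ideal_gen_base\<close>)
  have 2: "ideal_gen F \<subseteq> {x. x * y \<in> ?R}" if "y \<in> ideal_gen G" for y
    by (subst ideal_gen_subset_iff)
       (use that 1 in \<open>auto simp: ideal_zero distrib_right ideal_add mult.assoc
          ideal_mult_left intro!: is_idealI\<close>)
  then show "?L \<subseteq> ?R"
    by (auto intro!: ideal_gen_subset_ideal_genI)
  show "?R \<subseteq> ?L"
    by (rule ideal_gen_mono) (auto intro: ideal_gen_base)
qed

section \<open>Powers of ideals\<close>

lemma is_ideal_ideal_pow [simp]: "is_ideal (ideal_pow a m)"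
  by (cases m) auto

lemma ideal_pow_Suc_memI: "x \<in> a \<Longrightarrow> y \<in> ideal_pow a m \<Longrightarrow> x * y \<in> ideal_pow a (Suc m)"
  by (auto intro!: ideal_gen_base)

lemma power_in_ideal_pow: "x \<in> a \<Longrightarrow> x ^ m \<in> ideal_pow a m"
proof (induction m)
  case (Suc m)
  then show ?case using ideal_pow_Suc_memI[of x a "x ^ m" m] by simp
qed simp

lemma ideal_pow_mult_mem:
  "x \<in> ideal_pow a m \<Longrightarrow> y \<in> ideal_pow a n \<Longrightarrow> x * y \<in> ideal_pow a (m + n)"
proof (induction m arbitrary: x)
  case 0
  then show ?case by (simp add: ideal_mult_left)
next
  case (Suc m)
  have "ideal_pow a (Suc m) \<subseteq> {x. x * y \<in> ideal_pow a (Suc m + n)}"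
    unfolding ideal_pow.simps(2)[of a m]
  proof (subst ideal_gen_subset_iff)
    show "is_ideal {x. x * y \<in> ideal_pow a (Suc m + n)}"
      by (auto intro!: is_idealI simp del: ideal_pow.simps
          simp: ideal_zero distrib_right ideal_add mult.assoc ideal_mult_left)
    show "{x * y |x y. x \<in> a \<and> y \<in> ideal_pow a m} \<subseteq> {x. x * y \<in> ideal_pow a (Suc m + n)}"
    proof clarify
      fix u v assume "u \<in> a" "v \<in> ideal_pow a m"
      then have "u * (v * y) \<in> ideal_pow a (Suc (m + n))"
        by (intro ideal_pow_Suc_memI Suc.IH Suc.prems(2))
      then show "u * v * y \<in> ideal_pow a (Suc m + n)"
        by (simp add: mult.assoc del: ideal_pow.simps)
    qed
  qed
  with Suc.prems(1) show ?case by blast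
qed

lemma ideal_pow_power_mem: "x \<in> ideal_pow a m \<Longrightarrow> x ^ n \<in> ideal_pow a (n * m)"
  by (induction n) (auto intro: ideal_pow_mult_mem)

lemma ideal_pow_antimono: "m \<le> n \<Longrightarrow> ideal_pow a n \<subseteq> ideal_pow a m"
proof (induction n rule: dec_induct)
  case (step n)
  have "ideal_pow a (Suc n) \<subseteq> ideal_pow a n"
    by (auto simp: ideal_gen_subset_iff ideal_mult_left)
  with step show ?case by blast
qed simp

text \<open>A ring homomorphism need not map ideals onto ideals, so the statement is about extended
  ideals. It is applied to the map that sets variables to zero.\<close>

lemma ideal_pow_image_ideal_gen:
  assumes h: "\<And>x y. h (x * y) = h x * h y" "h 0 = 0" "h 1 = 1" "\<And>x y. h (x + y) = h x + h y"
  shows "ideal_pow (ideal_gen (h ` a)) m = ideal_gen (h ` ideal_pow a m)"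
proof (induction m)
  case 0
  have "1 \<in> ideal_gen (range h)"
    using h(3) by (metis ideal_gen_base rangeI)
  then have "x \<in> ideal_gen (range h)" for x
    using ideal_mult_left[of "ideal_gen (range h)" 1 x] by simp
  then show ?case by auto
next
  case (Suc m)
  let ?X = "{x * y |x y. x \<in> a \<and> y \<in> ideal_pow a m}"
  have "{x * y |x y. x \<in> h ` a \<and> y \<in> h ` ideal_pow a m} = h ` ?X"
  proof (intro set_eqI iffI)
    fix z assume "z \<in> h ` ?X"
    then obtain x y where "z = h x * h y" "x \<in> a" "y \<in> ideal_pow a m" by (auto simp: h(1))
    then show "z \<in> {x * y |x y. x \<in> h ` a \<and> y \<in> h ` ideal_pow a m}" by blast
  next
    fix z assume "z \<in> {x * y |x y. x \<in> h ` a \<and> y \<in> h ` ideal_pow a m}"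
    then obtain x y where "z = h (x * y)" "x \<in> a" "y \<in> ideal_pow a m" by (auto simp: h(1))
    then show "z \<in> h ` ?X" by blast
  qed
  then have "ideal_pow (ideal_gen (h ` a)) (Suc m) = ideal_gen (h ` ?X)"
    by (simp add: Suc ideal_gen_products)
  also have "\<dots> = ideal_gen (h ` ideal_gen ?X)"
  proof
    have "ideal_gen ?X \<subseteq> {x. h x \<in> ideal_gen (h ` ?X)}"
      by (subst ideal_gen_subset_iff)
         (auto intro!: is_ideal_vimage simp: h intro: ideal_gen_base)
    then show "ideal_gen (h ` ideal_gen ?X) \<subseteq> ideal_gen (h ` ?X)"
      by (auto intro!: ideal_gen_subset_ideal_genI)
  qed (intro ideal_gen_mono image_mono ideal_gen_superset)
  finally show ?case by simp
qed

section \<open>Frobenius powers and colon ideals\<close>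

lemma is_ideal_frob_pow [simp]: "is_ideal (frob_pow J q)"
  by (simp add: frob_pow_def)

lemma power_in_frob_pow: "x \<in> J \<Longrightarrow> x ^ q \<in> frob_pow J q"
  by (auto simp: frob_pow_def intro: ideal_gen_base)

lemma frob_pow_subset_iff: "is_ideal I \<Longrightarrow> frob_pow J q \<subseteq> I \<longleftrightarrow> (\<forall>x\<in>J. x ^ q \<in> I)"
  by (auto simp: frob_pow_def ideal_gen_subset_iff)

definition ideal_colon :: "'a::comm_ring_1 set \<Rightarrow> 'a set \<Rightarrow> 'a set" where
  "ideal_colon L a = {x. \<forall>y\<in>a. x * y \<in> L}"

lemma is_ideal_ideal_colon: "is_ideal L \<Longrightarrow> is_ideal (ideal_colon L a)"
  by (auto simp: ideal_colon_def is_ideal_def distrib_right mult.assoc)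

lemma subset_ideal_colon: "is_ideal L \<Longrightarrow> L \<subseteq> ideal_colon L a"
  by (auto simp: ideal_colon_def ideal_mult_right)

section \<open>Monomials in a finite generating set\<close>

definition power_products :: "'a::comm_ring_1 set \<Rightarrow> nat \<Rightarrow> 'a set" where
  "power_products F m = {\<Prod>g\<in>F. g ^ u g | u. sum u F = m}"

text \<open>Pigeonhole: if all exponents \<open>u g\<close> were below \<open>k\<close>, then
  summing \<open>Suc (u g) \<le> k\<close> would give \<open>m + card F \<le> card F * k\<close>.
  The hypothesis is a lower bound on \<open>m\<close> written without subtraction.\<close>

lemma power_products_split:
  assumes "finite F" "x \<in> power_products F m" "card F * k < m + card F"
  obtains g y where "g \<in> F" "y \<in> power_products F (m - k)" "x = g ^ k * y"
proof -
  obtain u where u: "sum u F = m" "x = (\<Prod>g\<in>F. g ^ u g)"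
    using assms(2) by (auto simp: power_products_def)
  obtain g where g: "g \<in> F" "u g \<ge> k"
  proof (rule ccontr)
    assume "\<not> thesis"
    then have "sum (\<lambda>g. Suc (u g)) F \<le> (\<Sum>g\<in>F. k)"
      using that by (intro sum_mono) (auto simp: not_le[symmetric] Suc_le_eq)
    with u assms(3) show False by (simp add: sum_Suc)
  qed
  define w where "w = u(g := u g - k)"
  have "sum u F = u g + sum u (F - {g})" "sum w F = w g + sum w (F - {g})"
    using g assms(1) by (auto simp: sum.remove)
  moreover have "sum w (F - {g}) = sum u (F - {g})"
    by (intro sum.cong) (auto simp: w_def)
  ultimately have w: "sum w F = m - k" using g u(1) by (simp add: w_def)
  have "(\<Prod>h\<in>F. h ^ u h) = g ^ u g * (\<Prod>h\<in>F-{g}. h ^ u h)"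
       "(\<Prod>h\<in>F. h ^ w h) = g ^ w g * (\<Prod>h\<in>F-{g}. h ^ w h)"
    using g assms(1) by (auto simp: prod.remove)
  moreover have "(\<Prod>h\<in>F-{g}. h ^ w h) = (\<Prod>h\<in>F-{g}. h ^ u h)"
    by (intro prod.cong) (auto simp: w_def)
  ultimately have "x = g ^ k * (\<Prod>h\<in>F. h ^ w h)"
    using g u(2) by (simp add: w_def mult.assoc[symmetric] power_add[symmetric])
  then show ?thesis
    using that[of g "\<Prod>h\<in>F. h ^ w h"] g w by (auto simp: power_products_def)
qed

lemma power_products_Suc:
  assumes "finite F"
  shows "power_products F (Suc m) = {x * y | x y. x \<in> F \<and> y \<in> power_products F m}"
proof
  show "power_products F (Suc m) \<subseteq> {x * y | x y. x \<in> F \<and> y \<in> power_products F m}"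
    \<comment> \<open>With \<open>k = 1\<close> the pigeonhole condition reads
      \<open>card F < Suc m + card F\<close>, which always holds.\<close>
    using power_products_split[OF assms, of _ "Suc m" 1] by auto blast
  show "{x * y | x y. x \<in> F \<and> y \<in> power_products F m} \<subseteq> power_products F (Suc m)"
  proof clarify
    fix g y assume g: "g \<in> F" and "y \<in> power_products F m"
    then obtain u where u: "sum u F = m" "y = (\<Prod>g\<in>F. g ^ u g)"
      by (auto simp: power_products_def)
    define w where "w = u(g := Suc (u g))"
    have "sum u F = u g + sum u (F - {g})" "sum w F = w g + sum w (F - {g})"
      using g assms(1) by (auto simp: sum.remove)
    moreover have "sum w (F - {g}) = sum u (F - {g})"
      by (intro sum.cong) (auto simp: w_def)
    ultimately have w: "sum w F = Suc m" using g u(1) by (simp add: w_def)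
    have "(\<Prod>h\<in>F. h ^ u h) = g ^ u g * (\<Prod>h\<in>F-{g}. h ^ u h)"
         "(\<Prod>h\<in>F. h ^ w h) = g ^ w g * (\<Prod>h\<in>F-{g}. h ^ w h)"
      using g assms(1) by (auto simp: prod.remove)
    moreover have "(\<Prod>h\<in>F-{g}. h ^ w h) = (\<Prod>h\<in>F-{g}. h ^ u h)"
      by (intro prod.cong) (auto simp: w_def)
    ultimately have "g * y = (\<Prod>h\<in>F. h ^ w h)"
      using u(2) by (simp add: mult.assoc w_def)
    then show "g * y \<in> power_products F (Suc m)"
      using w by (auto simp: power_products_def)
  qed
qed

lemma ideal_pow_ideal_gen:
  assumes "finite F"
  shows "ideal_pow (ideal_gen F) m = ideal_gen (power_products F m)"
proof (induction m)
  case 0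
  have "(1::'a) \<in> power_products F 0"
    unfolding power_products_def by (rule CollectI, rule exI[of _ "\<lambda>_. 0"]) auto
  then have "1 \<in> ideal_gen (power_products F 0)" by (rule ideal_gen_base)
  then have "x \<in> ideal_gen (power_products F 0)" for x
    using ideal_mult_left[of "ideal_gen (power_products F 0)" 1 x] by simp
  then show ?case by auto
next
  case (Suc m)
  then show ?case by (simp add: power_products_Suc[OF assms] ideal_gen_products)
qed

text \<open>With \<open>k = q\<close> this is the nontrivial half of a^m = a^[q] a^(m-q) for large
  \<open>m\<close>; with \<open>k\<close> a suitable multiple of \<open>q\<close> it pushes high
  powers into a Frobenius power.\<close>

lemma ideal_pow_pigeonhole:
  assumes "finite F" "card F * k < m + card F"
  shows "ideal_pow (ideal_gen F) m
    \<subseteq> ideal_gen {g ^ k * y | g y. g \<in> F \<and> y \<in> ideal_pow (ideal_gen F) (m - k)}"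
proof -
  have "power_products F m \<subseteq> {g ^ k * y | g y. g \<in> F \<and> y \<in> ideal_pow (ideal_gen F) (m - k)}"
    using power_products_split[OF assms(1) _ assms(2)]
    by (auto simp: ideal_pow_ideal_gen[OF assms(1)]) (metis ideal_gen_base)
  then show ?thesis
    by (subst ideal_pow_ideal_gen[OF assms(1)]) (rule ideal_gen_mono)
qed

section \<open>Polynomials\<close>

type_synonym ('v, 'k) mpoly = "('v \<Rightarrow>\<^sub>0 nat) \<Rightarrow>\<^sub>0 'k"

abbreviation lookup where "lookup \<equiv> Poly_Mapping.lookup"
abbreviation keys where "keys \<equiv> Poly_Mapping.keys"
abbreviation single where "single \<equiv> Poly_Mapping.single"

lemma lookup_single_mult_add:
  fixes f :: "'a::cancel_comm_monoid_add \<Rightarrow>\<^sub>0 'b::comm_semiring_1"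
  shows "lookup (single \<beta> c * f) (\<beta> + \<alpha>) = c * lookup f \<alpha>"
  by (simp add: lookup_mult lookup_single when_mult)

lemma lookup_single_mult_eq_0:
  fixes f :: "'a::cancel_comm_monoid_add \<Rightarrow>\<^sub>0 'b::comm_semiring_1"
  assumes "\<And>\<alpha>. \<gamma> \<noteq> \<beta> + \<alpha>"
  shows "lookup (single \<beta> c * f) \<gamma> = 0"
  using assms by (simp add: lookup_mult lookup_single when_mult)

lemma lookup_const_mult [simp]:
  fixes f :: "'a::cancel_comm_monoid_add \<Rightarrow>\<^sub>0 'b::comm_semiring_1"
  shows "lookup (single 0 c * f) \<alpha> = c * lookup f \<alpha>"
  using lookup_single_mult_add[of 0 c f \<alpha>] by simp

lemma poly_mapping_eq_sum_single: "f = (\<Sum>\<alpha>\<in>keys f. single \<alpha> (lookup f \<alpha>))"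
  by (rule poly_mapping_eqI) (simp add: lookup_sum lookup_single when_def in_keys_iff)

lemma CHAR_mpoly:
  "CHAR('a::comm_monoid_add \<Rightarrow>\<^sub>0 'k::comm_ring_1) = CHAR('k)"
proof (rule CHAR_eqI)
  show "of_nat CHAR('k) = (0::'a \<Rightarrow>\<^sub>0 'k)"
    by (metis of_nat_CHAR single_of_nat single_zero)
  fix n assume "of_nat n = (0::'a \<Rightarrow>\<^sub>0 'k)"
  then have "lookup (of_nat n :: 'a \<Rightarrow>\<^sub>0 'k) 0 = 0" by simp
  then have "of_nat n = (0::'k)" by (simp add: lookup_of_nat)
  then show "CHAR('k) dvd n" by (simp add: of_nat_eq_0_iff_char_dvd)
qed

section \<open>Scaled exponents and divisibility of monomials\<close>

definition exp_scale :: "nat \<Rightarrow> ('v \<Rightarrow>\<^sub>0 nat) \<Rightarrow> ('v \<Rightarrow>\<^sub>0 nat)" where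
  "exp_scale q \<alpha> = Poly_Mapping.map ((*) q) \<alpha>"

lemma lookup_exp_scale [simp]: "lookup (exp_scale q \<alpha>) v = q * lookup \<alpha> v"
  by (simp add: exp_scale_def map.rep_eq when_def)

lemma exp_scale_add: "exp_scale q (\<alpha> + \<beta>) = exp_scale q \<alpha> + exp_scale q \<beta>"
  by (rule poly_mapping_eqI) (simp add: lookup_add distrib_left)

lemma exp_scale_inject: "q > 0 \<Longrightarrow> exp_scale q \<alpha> = exp_scale q \<beta> \<longleftrightarrow> \<alpha> = \<beta>"
  by (auto simp: poly_mapping_eq_iff fun_eq_iff)

lemma single_power: "single \<alpha> c ^ q = single (exp_scale q \<alpha>) (c ^ q)"
proof (induction q)
  case 0
  have "exp_scale 0 \<alpha> = 0" by (rule poly_mapping_eqI) simp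
  then show ?case by simp
next
  case (Suc q)
  have "\<alpha> + exp_scale q \<alpha> = exp_scale (Suc q) \<alpha>"
    by (rule poly_mapping_eqI) (simp add: lookup_add)
  then show ?case by (simp add: Suc mult_single)
qed

lemma exp_dvd_iff: "(\<exists>\<gamma>. \<alpha> = \<beta> + \<gamma>) \<longleftrightarrow> (\<forall>v. lookup \<beta> v \<le> lookup (\<alpha> :: 'v \<Rightarrow>\<^sub>0 nat) v)"
proof
  assume "\<forall>v. lookup \<beta> v \<le> lookup \<alpha> v"
  then have "\<alpha> = \<beta> + (\<alpha> - \<beta>)"
    by (intro poly_mapping_eqI) (simp add: lookup_add lookup_minus)
  then show "\<exists>\<gamma>. \<alpha> = \<beta> + \<gamma>" by blast
qed (auto simp: lookup_add)

lemma finite_bounded_exponents: "finite {\<alpha> :: 'v::finite \<Rightarrow>\<^sub>0 nat. \<forall>v. lookup \<alpha> v \<le> D}" (is "finite ?A")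
proof (rule inj_on_finite)
  show "inj_on lookup ?A"
    by (intro inj_onI poly_mapping_eqI) metis
  show "lookup ` ?A \<subseteq> {f. \<forall>v. (v \<in> UNIV \<longrightarrow> f v \<in> {..D}) \<and> (v \<notin> UNIV \<longrightarrow> f v = 0)}"
    by auto
  show "finite {f. \<forall>v::'v. (v \<in> UNIV \<longrightarrow> f v \<in> {..D}) \<and> (v \<notin> UNIV \<longrightarrow> f v = 0)}"
    by (rule finite_set_of_finite_funs) (rule finite finite_atMost)+
qed

subsection \<open>A monomial order and Hilbert's basis theorem\<close>

text \<open>Sending the variables to distinct primes embeds the monoid of exponents into the
  multiplicative monoid of positive integers; the usual order of the integers
  then yields a well-founded monomial order without any order on the variables.\<close>

definition variable_prime :: "'v::finite \<Rightarrow> nat" where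
  "variable_prime = (SOME f. inj f \<and> (\<forall>v. prime (f v)))"

lemma inj_variable_prime: "inj (variable_prime :: 'v::finite \<Rightarrow> nat)"
  and prime_variable_prime: "prime (variable_prime (v::'v))"
proof -
  obtain P :: "nat set" where P: "P \<subseteq> {p. prime p}" "card P = card (UNIV :: 'v set)" "finite P"
    using infinite_arbitrarily_large[OF primes_infinite, of "card (UNIV :: 'v set)"] by auto
  then obtain f :: "'v \<Rightarrow> nat" where "bij_betw f UNIV P"
    by (metis finite_UNIV finite_same_card_bij)
  then have "inj f \<and> (\<forall>v. prime (f v))"
    using P(1) by (auto simp: bij_betw_def)
  then have "inj (variable_prime :: 'v \<Rightarrow> nat) \<and> (\<forall>v::'v. prime (variable_prime v))"
    unfolding variable_prime_def by (rule someI[of "\<lambda>f. inj f \<and> (\<forall>v. prime (f v))"])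
  then show "inj (variable_prime :: 'v \<Rightarrow> nat)" "prime (variable_prime (v::'v))" by auto
qed

lemma variable_prime_nonzero: "variable_prime v \<noteq> 0"
  using prime_gt_0_nat[OF prime_variable_prime[of v]] by simp

definition exp_code :: "('v::finite \<Rightarrow>\<^sub>0 nat) \<Rightarrow> nat" where
  "exp_code \<alpha> = (\<Prod>v\<in>UNIV. variable_prime v ^ lookup \<alpha> v)"

lemma exp_code_add: "exp_code (\<alpha> + \<beta>) = exp_code \<alpha> * exp_code \<beta>"
  by (simp add: exp_code_def lookup_add power_add prod.distrib)

lemma exp_code_pos: "exp_code \<alpha> > 0"
  by (auto simp: exp_code_def intro!: prod_pos prime_gt_0_nat prime_variable_prime)

lemma multiplicity_exp_code: "multiplicity (variable_prime v) (exp_code \<alpha>) = lookup \<alpha> v"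
proof -
  have "multiplicity (variable_prime v) (exp_code \<alpha>) =
      (\<Sum>w\<in>UNIV. multiplicity (variable_prime v) (variable_prime w ^ lookup \<alpha> w))"
    unfolding exp_code_def
    by (subst prime_elem_multiplicity_prod_distrib)
       (auto simp: prime_variable_prime variable_prime_nonzero)
  also have "\<dots> = (\<Sum>w\<in>UNIV. if w = v then lookup \<alpha> w else 0)"
    by (intro sum.cong)
       (auto simp: prime_variable_prime multiplicity_distinct_prime_power inj_eq[OF inj_variable_prime]
          prime_multiplicity_other)
  finally show ?thesis by simp
qed

lemma inj_exp_code: "exp_code \<alpha> = exp_code \<beta> \<Longrightarrow> \<alpha> = \<beta>"
  by (rule poly_mapping_eqI) (metis multiplicity_exp_code)

text \<open>The value is unspecified for the zero polynomial, which is why nonzero hypotheses appear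
  below.\<close>

definition lead :: "('v::finite, 'k::zero) mpoly \<Rightarrow> 'v \<Rightarrow>\<^sub>0 nat" where
  "lead f = arg_max_on exp_code (keys f)"

lemma lead_in_keys: "f \<noteq> 0 \<Longrightarrow> lead f \<in> keys f"
  and exp_code_le_lead: "\<beta> \<in> keys f \<Longrightarrow> exp_code \<beta> \<le> exp_code (lead f)"
proof -
  have *: "lead f \<in> keys f \<and> (\<forall>\<beta>\<in>keys f. exp_code \<beta> \<le> exp_code (lead f))" if "keys f \<noteq> {}"
  proof -
    have "Max (exp_code ` keys f) \<in> exp_code ` keys f"
      using that by (intro Max_in) auto
    then obtain \<alpha> where \<alpha>: "\<alpha> \<in> keys f" "exp_code \<alpha> = Max (exp_code ` keys f)"
      by (metis imageE)
    then have "is_arg_max exp_code (\<lambda>x. x \<in> keys f) \<alpha>"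
      by (auto simp: is_arg_max_linorder)
    then have "is_arg_max exp_code (\<lambda>x. x \<in> keys f) (lead f)"
      unfolding lead_def arg_max_on_def arg_max_def by (rule someI)
    then show ?thesis by (auto simp: is_arg_max_linorder)
  qed
  show "f \<noteq> 0 \<Longrightarrow> lead f \<in> keys f"
    using * by (metis keys_eq_empty)
  show "\<beta> \<in> keys f \<Longrightarrow> exp_code \<beta> \<le> exp_code (lead f)" using * by blast
qed

lemma lead_eqI:
  assumes "\<alpha> \<in> keys f" "\<And>\<beta>. \<beta> \<in> keys f \<Longrightarrow> exp_code \<beta> \<le> exp_code \<alpha>"
  shows "lead f = \<alpha>"
proof (rule inj_exp_code)
  have "f \<noteq> 0" using assms(1) by auto
  with assms show "exp_code (lead f) = exp_code \<alpha>"
    by (intro antisym) (auto intro: lead_in_keys exp_code_le_lead)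
qed

text \<open>At the sum of the two leading exponents only the leading terms meet: any other exponent
  of \<open>f\<close> has a strictly smaller code, so its partner in \<open>g\<close> would need a
  code above that of \<open>lead g\<close>.\<close>

lemma lookup_mult_lead:
  fixes f g :: "('v::finite, 'k::comm_ring_1) mpoly"
  assumes "f \<noteq> 0"
  shows "lookup (f * g) (lead f + lead g) = lookup f (lead f) * lookup g (lead g)"
proof -
  have 1: "lookup (single \<alpha> c * g) (lead f + lead g) = 0"
    if "\<alpha> \<in> keys f - {lead f}" for \<alpha> c
  proof (cases "\<exists>\<delta>. lead f + lead g = \<alpha> + \<delta>")
    case True
    then obtain \<delta> where \<delta>: "lead f + lead g = \<alpha> + \<delta>" by blast
    have "\<delta> \<notin> keys g"
    proof
      assume "\<delta> \<in> keys g"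
      then have "exp_code \<delta> \<le> exp_code (lead g)" by (rule exp_code_le_lead)
      moreover have "exp_code \<alpha> < exp_code (lead f)"
        using that exp_code_le_lead[of \<alpha> f] inj_exp_code[of \<alpha> "lead f"] by fastforce
      ultimately have "exp_code \<alpha> * exp_code \<delta> < exp_code (lead f) * exp_code (lead g)"
        by (intro mult_less_le_imp_less) (auto simp: exp_code_pos)
      with \<delta> show False by (metis exp_code_add less_irrefl)
    qed
    then show ?thesis
      unfolding \<delta> by (simp add: lookup_single_mult_add in_keys_iff)
  next
    case False
    then show ?thesis by (intro lookup_single_mult_eq_0) blast
  qed
  have "f * g = (\<Sum>\<alpha>\<in>keys f. single \<alpha> (lookup f \<alpha>) * g)"
    using arg_cong[OF poly_mapping_eq_sum_single[of f], of "\<lambda>h. h * g"]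
    by (simp add: sum_distrib_right)
  then have "lookup (f * g) (lead f + lead g) =
      (\<Sum>\<alpha>\<in>keys f. lookup (single \<alpha> (lookup f \<alpha>) * g) (lead f + lead g))"
    by (simp add: lookup_sum)
  also have "\<dots> = lookup (single (lead f) (lookup f (lead f)) * g) (lead f + lead g)"
    by (subst sum.remove[of _ "lead f"]) (auto simp: lead_in_keys[OF assms] sum.neutral 1)
  finally show ?thesis by (simp add: lookup_single_mult_add)
qed

lemma mpoly_mult_nonzero:
  fixes f g :: "('v::finite, 'k::field) mpoly"
  assumes "f \<noteq> 0" "g \<noteq> 0"
  shows "f * g \<noteq> 0"
proof -
  have "lookup (f * g) (lead f + lead g) \<noteq> 0"
    using assms lead_in_keys[of f] lead_in_keys[of g] by (simp add: lookup_mult_lead in_keys_iff)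
  then show ?thesis by auto
qed

text \<open>Elimination of leading terms: subtracting a scalar multiple of an element of
  \<open>W\<close> lowers the code of the lead. The closure conditions are those of vector spaces,
  so that the lemma serves ideals as well as the finite-dimensional pieces used to count
  thresholds.\<close>

lemma subset_by_leads:
  fixes V W :: "('v::finite, 'k::field) mpoly set"
  assumes W: "0 \<in> W" "\<And>f g. f \<in> W \<Longrightarrow> g \<in> W \<Longrightarrow> f + g \<in> W"
      "\<And>c g. g \<in> W \<Longrightarrow> single 0 c * g \<in> W"
    and V: "W \<subseteq> V" "\<And>f g. f \<in> V \<Longrightarrow> g \<in> V \<Longrightarrow> f - g \<in> V"
    and lead: "\<And>f. f \<in> V \<Longrightarrow> f \<noteq> 0 \<Longrightarrow> \<exists>g\<in>W. g \<noteq> 0 \<and> lead g = lead f"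
  shows "V \<subseteq> W"
proof
  fix f assume "f \<in> V"
  then show "f \<in> W"
  \<comment> \<open>The zero polynomial gets measure 0, below all others because codes are
    positive.\<close>
  proof (induction "if f = 0 then 0 else exp_code (lead f)" arbitrary: f rule: less_induct)
    case less
    show ?case
    proof (cases "f = 0")
      case False
      then obtain g where g: "g \<in> W" "g \<noteq> 0" "lead g = lead f"
        using lead less.prems by blast
      define c where "c = lookup f (lead f) / lookup g (lead g)"
      define h where "h = f - single 0 c * g"
      have h_lookup: "lookup h \<alpha> = lookup f \<alpha> - c * lookup g \<alpha>" for \<alpha>
        by (simp add: h_def lookup_minus)
      have "h \<in> V" unfolding h_def using g(1) W(3) V(1) by (intro V(2) less.prems) auto
      moreover have "(if h = 0 then 0 else exp_code (lead h)) < exp_code (lead f)"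
      proof (cases "h = 0")
        case True
        then show ?thesis by (simp add: exp_code_pos)
      next
        case h: False
        have "lookup h (lead f) = 0"
          using lead_in_keys[OF g(2)] g(3) by (simp add: h_lookup c_def in_keys_iff)
        then have ne: "lead h \<noteq> lead f"
          using lead_in_keys[OF h] by (auto simp: in_keys_iff)
        have "lead h \<in> keys f \<or> lead h \<in> keys g"
          using lead_in_keys[OF h] by (auto simp: in_keys_iff h_lookup)
        then have "exp_code (lead h) \<le> exp_code (lead f)"
          using exp_code_le_lead g(3) by metis
        then show ?thesis using h ne inj_exp_code by (auto simp: le_less)
      qed
      ultimately have "h \<in> W" using less.hyps[of h] False by simp
      then have "h + single 0 c * g \<in> W" using W g(1) by auto
      then show ?thesis by (simp add: h_def)
    qed (use W in simp)
  qed
qed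

section \<open>Dickson's lemma\<close>

lemma nat_seq_mono_subseq:
  fixes t :: "nat \<Rightarrow> nat"
  obtains r :: "nat \<Rightarrow> nat" where "strict_mono r" "mono (\<lambda>i. t (r i))"
proof -
  obtain r :: "nat \<Rightarrow> nat" where r: "strict_mono r" "monoseq (\<lambda>i. t (r i))"
    using seq_monosub by blast
  show ?thesis
  proof (cases "\<forall>m n. m \<le> n \<longrightarrow> t (r m) \<le> t (r n)")
    case True
    then show ?thesis using that[OF r(1)] by (auto simp: mono_def)
  next
    case False
    then have dec: "t (r n) \<le> t (r m)" if "m \<le> n" for m n
      using r(2) that by (auto simp: monoseq_def)
    \<comment> \<open>A nonincreasing sequence of naturals is constant once it reaches its minimum,
      and a constant tail is monotone.\<close>
    define L where "L = (LEAST x. x \<in> range (\<lambda>i. t (r i)))"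
    have "L \<in> range (\<lambda>i. t (r i))"
      unfolding L_def by (rule LeastI[of _ "t (r 0)"]) auto
    then obtain k where k: "t (r k) = L" by auto
    have L: "L \<le> t (r i)" for i unfolding L_def by (rule Least_le) auto
    have "t (r (k + i)) = L" for i
      using dec[of k "k + i"] k L[of "k + i"] by auto
    moreover have "strict_mono (\<lambda>i. r (k + i))"
      using r(1) by (auto simp: strict_mono_def)
    ultimately show ?thesis using that[of "\<lambda>i. r (k + i)"] by (simp add: mono_def)
  qed
qed

text \<open>Thin out the sequence for one variable at a time; a further subsequence keeps the
  monotonicity already achieved.\<close>

lemma seq_mono_subseq_all:
  fixes s :: "nat \<Rightarrow> 'v \<Rightarrow> nat"
  assumes "finite A"
  shows "\<exists>r :: nat \<Rightarrow> nat. strict_mono r \<and> (\<forall>v\<in>A. mono (\<lambda>i. s (r i) v))"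
  using assms
proof induction
  case empty
  then show ?case by (auto intro: exI[of _ id] strict_mono_id)
next
  case (insert v A)
  then obtain r :: "nat \<Rightarrow> nat" where r: "strict_mono r" "\<forall>v\<in>A. mono (\<lambda>i. s (r i) v)" by blast
  obtain r' :: "nat \<Rightarrow> nat" where r': "strict_mono r'" "mono (\<lambda>i. s (r (r' i)) v)"
    using nat_seq_mono_subseq[of "\<lambda>i. s (r i) v"] by blast
  have "strict_mono (\<lambda>i. r (r' i))" using r(1) r'(1) by (auto simp: strict_mono_def)
  moreover have "mono (\<lambda>i. s (r (r' i)) w)" if "w \<in> A" for w
    using r(2) r'(1) that by (auto simp: mono_def strict_mono_less_eq)
  ultimately show ?case using r'(2) by (intro exI[of _ "\<lambda>i. r (r' i)"]) auto
qed

text \<open>The elements minimal for divisibility do it. Infinitely many of them would contain a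
  sequence nondecreasing in every coordinate, hence two distinct comparable ones; and each exponent
  lies above a minimal one because proper divisors have smaller \<open>exp_code\<close>.\<close>

lemma dickson:
  fixes X :: "('v::finite \<Rightarrow>\<^sub>0 nat) set"
  obtains B where "finite B" "B \<subseteq> X" "\<And>\<alpha>. \<alpha> \<in> X \<Longrightarrow> \<exists>\<beta>\<in>B. \<exists>\<gamma>. \<alpha> = \<beta> + \<gamma>"
proof
  define B where "B = {\<beta>\<in>X. \<forall>\<beta>'\<in>X. (\<exists>\<gamma>. \<beta> = \<beta>' + \<gamma>) \<longrightarrow> \<beta>' = \<beta>}"
  show "B \<subseteq> X" by (auto simp: B_def)
  show "finite B"
  proof (rule ccontr)
    assume "infinite B"
    then obtain s :: "nat \<Rightarrow> 'v \<Rightarrow>\<^sub>0 nat" where s: "inj s" "range s \<subseteq> B"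
      using infinite_countable_subset by blast
    obtain r :: "nat \<Rightarrow> nat" where r: "strict_mono r" "\<forall>v\<in>UNIV. mono (\<lambda>i. lookup (s (r i)) v)"
      using seq_mono_subseq_all[of UNIV "\<lambda>i. lookup (s i)"] by auto
    have "\<exists>\<gamma>. s (r 1) = s (r 0) + \<gamma>"
      using r(2) by (auto simp: exp_dvd_iff mono_def)
    then have "s (r 0) = s (r 1)"
      using s(2) unfolding B_def by blast
    then have "r 0 = r 1" using s(1) by (auto simp: inj_def)
    then show False using strict_monoD[OF r(1), of 0 1] by simp
  qed
  show "\<exists>\<beta>\<in>B. \<exists>\<gamma>. \<alpha> = \<beta> + \<gamma>" if "\<alpha> \<in> X" for \<alpha>
    using that
  proof (induction "exp_code \<alpha>" arbitrary: \<alpha> rule: less_induct)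
    case less
    show ?case
    proof (cases "\<alpha> \<in> B")
      case True
      then show ?thesis by (metis add.right_neutral)
    next
      case False
      then obtain \<beta>' \<gamma> where b: "\<beta>' \<in> X" "\<alpha> = \<beta>' + \<gamma>" "\<beta>' \<noteq> \<alpha>"
        using less.prems by (auto simp: B_def)
      then have "exp_code \<beta>' \<noteq> exp_code \<alpha>" using inj_exp_code by blast
      moreover have "exp_code \<beta>' \<le> exp_code \<alpha>"
        using b(2) exp_code_pos[of \<gamma>] by (simp add: exp_code_add)
      ultimately obtain \<beta> \<delta> where "\<beta> \<in> B" "\<beta>' = \<beta> + \<delta>"
        using less.hyps[of \<beta>'] b(1) by auto
      then show ?thesis using b(2) by (metis add.assoc)
    qed
  qed
qed

lemma lead_monomial_mult:
  fixes f :: "('v::finite, 'k::field) mpoly"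
  assumes "f \<noteq> 0"
  shows "lead (single \<gamma> 1 * f) = \<gamma> + lead f" "single \<gamma> 1 * f \<noteq> 0"
proof -
  show "lead (single \<gamma> 1 * f) = \<gamma> + lead f"
  proof (rule lead_eqI)
    show "\<gamma> + lead f \<in> keys (single \<gamma> 1 * f)"
      using lead_in_keys[OF assms] by (simp add: in_keys_iff lookup_single_mult_add)
    fix \<beta> assume \<beta>: "\<beta> \<in> keys (single \<gamma> 1 * f)"
    then obtain \<alpha> where \<alpha>: "\<beta> = \<gamma> + \<alpha>"
      using lookup_single_mult_eq_0[of \<beta> \<gamma> 1 f] by (auto simp: in_keys_iff)
    then have "\<alpha> \<in> keys f" using \<beta> by (simp add: in_keys_iff lookup_single_mult_add)
    then show "exp_code \<beta> \<le> exp_code (\<gamma> + lead f)"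
      unfolding \<alpha> exp_code_add by (intro mult_le_mono2 exp_code_le_lead)
  qed
  show "single \<gamma> 1 * f \<noteq> 0"
    using lookup_single_mult_add[of \<gamma> 1 f "lead f"] lead_in_keys[OF assms]
    by (auto simp: in_keys_iff)
qed

text \<open>A Groebner basis argument: Dickson's lemma selects finitely many leading exponents, and
  monomial multiples of chosen elements with these leads attain every leading exponent of the
  ideal.\<close>

theorem hilbert_basis:
  fixes a :: "('v::finite, 'k::field) mpoly set"
  assumes a: "is_ideal a"
  obtains F where "finite F" "a = ideal_gen F"
proof -
  define X where "X = lead ` (a - {0})"
  obtain B where B: "finite B" "B \<subseteq> X" "\<And>\<alpha>. \<alpha> \<in> X \<Longrightarrow> \<exists>\<beta>\<in>B. \<exists>\<gamma>. \<alpha> = \<beta> + \<gamma>"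
    using dickson by blast
  have "\<forall>\<beta>\<in>B. \<exists>f. f \<in> a \<and> f \<noteq> 0 \<and> lead f = \<beta>"
    using B(2) by (auto simp: X_def)
  then obtain g where g: "\<And>\<beta>. \<beta> \<in> B \<Longrightarrow> g \<beta> \<in> a \<and> g \<beta> \<noteq> 0 \<and> lead (g \<beta>) = \<beta>"
    by metis
  have sub: "ideal_gen (g ` B) \<subseteq> a"
    using g a by (auto simp: ideal_gen_subset_iff)
  moreover have "a \<subseteq> ideal_gen (g ` B)"
  proof (rule subset_by_leads[OF _ _ _ sub])
    fix f assume "f \<in> a" "f \<noteq> 0"
    then obtain \<beta> \<gamma> where \<beta>: "\<beta> \<in> B" "lead f = \<beta> + \<gamma>" using B(3)[of "lead f"] by (auto simp: X_def)
    show "\<exists>h\<in>ideal_gen (g ` B). h \<noteq> 0 \<and> lead h = lead f"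
      using g[OF \<beta>(1)] \<beta> lead_monomial_mult[of "g \<beta>" \<gamma>]
      by (intro bexI[of _ "single \<gamma> 1 * g \<beta>"] conjI ideal_mult_left is_ideal_ideal_gen ideal_gen_base)
         (auto simp: add.commute)
  qed (auto simp: ideal_zero ideal_add ideal_mult_left intro: ideal_diff[OF a])
  ultimately show ?thesis using that[of "g ` B"] B(1) by auto
qed

section \<open>Coordinates with respect to Frobenius\<close>

text \<open>The field is a vector space over itself through \<open>c ^ q * x\<close>, where
  additivity in \<open>c\<close> is the freshman's dream; \<open>k b\<close> is the coordinate at
  the basis element \<open>b\<close>. These are q-th roots of the coordinates over the subfield of
  q-th powers.\<close>

lemma field_frobenius_coordinates:
  assumes "prime CHAR('k::field)" "q = CHAR('k::field) ^ e"
  obtains k :: "'k::field \<Rightarrow> 'k \<Rightarrow> 'k" where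
    "\<And>b x y. k b (x + y) = k b x + k b y"
    "\<And>b c x. k b (c ^ q * x) = c * k b x"
    "\<And>x. finite {b. k b x \<noteq> 0}"
    "\<And>x. (\<Sum>b | k b x \<noteq> 0. k b x ^ q * b) = x"
proof -
  interpret V: vector_space "\<lambda>c x :: 'k. c ^ q * x"
    by unfold_locales
       (auto simp: freshmans_dream'[OF assms] distrib_left distrib_right power_mult_distrib)
  obtain B where B: "V.independent B" "V.span B = UNIV"
    by (metis V.independent_empty V.independent_extend_basis V.span_extend_basis)
  show ?thesis
  proof
    fix b c x y
    show "V.representation B (x + y) b = V.representation B x b + V.representation B y b"
      using B by (simp add: V.representation_add)
    show "V.representation B (c ^ q * x) b = c * V.representation B x b"
      using B by (simp add: V.representation_scale)
    show "finite {b. V.representation B x b \<noteq> 0}" by (rule V.finite_representation)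
    show "(\<Sum>b | V.representation B x b \<noteq> 0. V.representation B x b ^ q * b) = x"
      using B by (simp add: V.sum_nonzero_representation_eq)
  qed
qed

text \<open>Expand \<open>f\<close> into terms x^\<open>\<beta>\<close> b g^q, with all entries of
  \<open>\<beta>\<close> below \<open>q\<close> and \<open>b\<close> a basis element of the field
  over its q-th powers. If \<open>k\<close> is the coordinate function of \<open>b\<close>, this is
  the polynomial g.\<close>

definition frob_coord ::
  "nat \<Rightarrow> ('k \<Rightarrow> 'k) \<Rightarrow> ('v \<Rightarrow>\<^sub>0 nat) \<Rightarrow> ('v, 'k::zero) mpoly \<Rightarrow> ('v, 'k) mpoly" where
  "frob_coord q k \<beta> f = Abs_poly_mapping (\<lambda>\<gamma>. k (lookup f (exp_scale q \<gamma> + \<beta>)))"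

lemma lookup_frob_coord:
  assumes "k 0 = 0" "q > 0"
  shows "lookup (frob_coord q k \<beta> f) \<gamma> = k (lookup f (exp_scale q \<gamma> + \<beta>))"
proof -
  have "inj (\<lambda>\<gamma>. exp_scale q \<gamma> + \<beta>)"
    using assms(2) by (auto intro!: injI simp: exp_scale_inject)
  then have "finite ((\<lambda>\<gamma>. exp_scale q \<gamma> + \<beta>) -` keys f)"
    by (intro finite_vimageI) auto
  then have "finite {\<gamma>. k (lookup f (exp_scale q \<gamma> + \<beta>)) \<noteq> 0}"
    by (rule rev_finite_subset) (auto simp: in_keys_iff assms(1))
  then show ?thesis by (simp add: frob_coord_def)
qed

lemma exp_division_unique:
  assumes "exp_scale q \<gamma> + \<beta> = exp_scale q \<gamma>' + \<beta>'"
    "\<And>v. lookup \<beta> v < q" "\<And>v. lookup \<beta>' v < q"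
  shows "\<gamma> = \<gamma>' \<and> \<beta> = \<beta>'"
proof -
  have eq: "q * lookup \<gamma> v + lookup \<beta> v = q * lookup \<gamma>' v + lookup \<beta>' v" for v
    using arg_cong[OF assms(1), of "\<lambda>x. lookup x v"] by (simp add: lookup_add)
  have "lookup \<gamma> v = lookup \<gamma>' v" for v
    using arg_cong[OF eq[of v], of "\<lambda>x. x div q"] assms(2,3)[of v] by simp
  moreover from this have "lookup \<beta> v = lookup \<beta>' v" for v using eq[of v] by simp
  ultimately show ?thesis by (auto intro: poly_mapping_eqI)
qed

lemma exp_division:
  assumes "q > 0"
  obtains \<gamma> \<beta> :: "'v::finite \<Rightarrow>\<^sub>0 nat" where "\<alpha> = exp_scale q \<gamma> + \<beta>" "\<And>v. lookup \<beta> v < q"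
proof
  define \<gamma> :: "'v \<Rightarrow>\<^sub>0 nat" where "\<gamma> = Abs_poly_mapping (\<lambda>v. lookup \<alpha> v div q)"
  define \<beta> :: "'v \<Rightarrow>\<^sub>0 nat" where "\<beta> = Abs_poly_mapping (\<lambda>v. lookup \<alpha> v mod q)"
  have "lookup \<gamma> v = lookup \<alpha> v div q" "lookup \<beta> v = lookup \<alpha> v mod q" for v
    by (simp_all add: \<gamma>_def \<beta>_def)
  then show "\<alpha> = exp_scale q \<gamma> + \<beta>" "\<And>v. lookup \<beta> v < q"
    using assms by (auto intro!: poly_mapping_eqI simp: lookup_add)
qed

lemma mpoly_frobenius_add:
  fixes f g :: "('v, 'k::field) mpoly"
  assumes "prime CHAR('k)" "q = CHAR('k) ^ e"
  shows "(f + g) ^ q = f ^ q + g ^ q"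
  using assms by (intro freshmans_dream') (simp_all add: CHAR_mpoly)

lemma mpoly_frobenius_eq_sum:
  fixes f :: "('v, 'k::field) mpoly"
  assumes "prime CHAR('k)" "q = CHAR('k) ^ e"
  shows "f ^ q = (\<Sum>\<alpha>\<in>keys f. single (exp_scale q \<alpha>) (lookup f \<alpha> ^ q))"
proof -
  have "f ^ q = (\<Sum>\<alpha>\<in>keys f. single \<alpha> (lookup f \<alpha>)) ^ q"
    using poly_mapping_eq_sum_single[of f] by simp
  also have "\<dots> = (\<Sum>\<alpha>\<in>keys f. single \<alpha> (lookup f \<alpha>) ^ q)"
    using assms by (intro freshmans_dream_sum') (simp_all add: CHAR_mpoly)
  finally show ?thesis by (simp add: single_power)
qed

lemma lookup_frobenius:
  fixes f :: "('v, 'k::field) mpoly"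
  assumes "prime CHAR('k)" "q = CHAR('k) ^ e"
  shows "lookup (f ^ q) (exp_scale q \<gamma>) = lookup f \<gamma> ^ q"
    and "(\<And>\<gamma>. \<alpha> \<noteq> exp_scale q \<gamma>) \<Longrightarrow> lookup (f ^ q) \<alpha> = 0"
proof -
  have q: "q > 0" using assms by (simp add: prime_gt_0_nat)
  show "lookup (f ^ q) (exp_scale q \<gamma>) = lookup f \<gamma> ^ q"
    using q by (subst mpoly_frobenius_eq_sum[OF assms])
      (simp add: lookup_sum lookup_single when_def exp_scale_inject in_keys_iff)
  show "lookup (f ^ q) \<alpha> = 0" if "\<And>\<gamma>. \<alpha> \<noteq> exp_scale q \<gamma>"
    using that by (subst mpoly_frobenius_eq_sum[OF assms])
      (simp add: lookup_sum lookup_single when_def not_sym[OF that])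
qed

text \<open>The coordinates are linear over q-th powers up to taking q-th roots. By additivity the
  second claim reduces to a single term of \<open>g\<close>, where both sides are shifts of
  exponents.\<close>

lemma frob_coord_semilinear:
  fixes f g :: "('v, 'k::field) mpoly"
  assumes pq: "prime CHAR('k)" "q = CHAR('k) ^ e"
    and k: "\<And>x y. k (x + y) = k x + k y" "\<And>c x. k (c ^ q * x) = c * k x"
    and \<beta>: "\<And>v. lookup \<beta> v < q"
  shows "frob_coord q k \<beta> (f + g) = frob_coord q k \<beta> f + frob_coord q k \<beta> g"
    and "frob_coord q k \<beta> (g ^ q * f) = g * frob_coord q k \<beta> f"
proof -
  have q: "q > 0" using pq by (simp add: prime_gt_0_nat)
  have k0: "k 0 = 0" using k(1)[of 0 0] by (metis add_0 add_cancel_right_right)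
  note lookup = lookup_frob_coord[of k q, OF k0 q]
  have add: "frob_coord q k \<beta> (f + g) = frob_coord q k \<beta> f + frob_coord q k \<beta> g" for f g
    by (rule poly_mapping_eqI) (simp add: lookup lookup_add k)
  then show "frob_coord q k \<beta> (f + g) = frob_coord q k \<beta> f + frob_coord q k \<beta> g" .
  have zero: "frob_coord q k \<beta> 0 = 0"
    by (rule poly_mapping_eqI) (simp add: lookup k0)
  have sum: "frob_coord q k \<beta> (sum F X) = (\<Sum>x\<in>X. frob_coord q k \<beta> (F x))"
    for F :: "('v \<Rightarrow>\<^sub>0 nat) \<Rightarrow> ('v, 'k) mpoly" and X
    by (induction X rule: infinite_finite_induct) (simp_all add: zero add)
  have mono: "frob_coord q k \<beta> (single (exp_scale q \<delta>) (c ^ q) * f) = single \<delta> c * frob_coord q k \<beta> f" for \<delta> c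
  proof (rule poly_mapping_eqI)
    fix \<gamma>
    show "lookup (frob_coord q k \<beta> (single (exp_scale q \<delta>) (c ^ q) * f)) \<gamma>
        = lookup (single \<delta> c * frob_coord q k \<beta> f) \<gamma>"
    proof (cases "\<exists>\<gamma>'. \<gamma> = \<delta> + \<gamma>'")
      case True
      then obtain \<gamma>' where \<gamma>: "\<gamma> = \<delta> + \<gamma>'" by blast
      show ?thesis
        by (simp add: \<gamma> lookup lookup_single_mult_add exp_scale_add add.assoc k)
    next
      case False
      \<comment> \<open>Entries of \<open>\<beta>\<close> are below \<open>q\<close>, so
        \<open>exp_scale q \<delta>\<close> divides \<open>exp_scale q \<gamma> + \<beta>\<close>
        only if \<open>\<delta>\<close> divides \<open>\<gamma>\<close>; otherwise both coefficients
        vanish.\<close>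
      have "exp_scale q \<gamma> + \<beta> \<noteq> exp_scale q \<delta> + \<alpha>" for \<alpha>
      proof
        assume "exp_scale q \<gamma> + \<beta> = exp_scale q \<delta> + \<alpha>"
        then have "q * lookup \<delta> v \<le> q * lookup \<gamma> v + lookup \<beta> v" for v
          by (metis le_add1 lookup_add lookup_exp_scale)
        then have "q * lookup \<delta> v < q * Suc (lookup \<gamma> v)" for v
          using \<beta>[of v] by (metis add.commute add_less_cancel_left le_less_trans mult_Suc_right)
        then have "\<forall>v. lookup \<delta> v \<le> lookup \<gamma> v"
          using q by (metis less_Suc_eq_le mult_less_cancel1)
        with False show False by (simp add: exp_dvd_iff)
      qed
      with False show ?thesis by (simp add: lookup lookup_single_mult_eq_0 k0)
    qed
  qed
  have "g ^ q * f = (\<Sum>\<alpha>\<in>keys g. single (exp_scale q \<alpha>) (lookup g \<alpha> ^ q) * f)"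
    by (simp add: mpoly_frobenius_eq_sum[OF pq] sum_distrib_right)
  then have "frob_coord q k \<beta> (g ^ q * f) = (\<Sum>\<alpha>\<in>keys g. single \<alpha> (lookup g \<alpha>)) * frob_coord q k \<beta> f"
    by (simp add: sum mono sum_distrib_right)
  then show "frob_coord q k \<beta> (g ^ q * f) = g * frob_coord q k \<beta> f"
    by (simp add: poly_mapping_eq_sum_single[symmetric])
qed

text \<open>Division with remainder assigns exactly one \<open>\<beta>\<close> to each exponent, and
  the inner sum recovers its coefficient. \<open>B\<close> is finite since it collects the basis
  elements occurring in the finitely many coefficients of \<open>f\<close>.\<close>

lemma frob_coord_reconstruct:
  fixes f :: "('v::finite, 'k::field) mpoly"
  assumes pq: "prime CHAR('k)" "q = CHAR('k) ^ e"
    and k: "\<And>b. k b 0 = 0" "\<And>x. finite {b. k b x \<noteq> 0}" "\<And>x. (\<Sum>b | k b x \<noteq> 0. k b x ^ q * b) = x"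
  defines "B \<equiv> (\<Union>\<alpha>\<in>keys f. {b. k b (lookup f \<alpha>) \<noteq> 0})"
  shows "f = (\<Sum>\<beta>\<in>{\<beta>. \<forall>v. lookup \<beta> v < q}. \<Sum>b\<in>B. single \<beta> b * frob_coord q (k b) \<beta> f ^ q)"
proof (rule poly_mapping_eqI)
  have q: "q > 0" using pq by (simp add: prime_gt_0_nat)
  let ?R = "{\<beta> :: 'v \<Rightarrow>\<^sub>0 nat. \<forall>v. lookup \<beta> v < q}"
  have fin: "finite ?R"
    by (rule finite_subset[OF _ finite_bounded_exponents[of q]]) (auto intro: less_imp_le)
  have finB: "finite B" by (auto simp: B_def k)
  fix \<alpha>
  obtain \<gamma> \<beta> :: "'v \<Rightarrow>\<^sub>0 nat" where \<alpha>: "\<alpha> = exp_scale q \<gamma> + \<beta>" and \<beta>: "\<And>v. lookup \<beta> v < q"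
    using exp_division[OF q] by metis
  have same: "lookup (single \<beta> b * frob_coord q (k b) \<beta> f ^ q) \<alpha> = k b (lookup f \<alpha>) ^ q * b" for b
    by (subst \<alpha>, subst add.commute, subst lookup_single_mult_add)
       (simp add: lookup_frobenius[OF pq] lookup_frob_coord q k(1) \<alpha>)
  have other: "lookup (single \<beta>' b * frob_coord q (k b) \<beta>' f ^ q) \<alpha> = 0"
    if "\<beta>' \<in> ?R - {\<beta>}" for b \<beta>'
  proof (cases "\<exists>\<delta>. \<alpha> = \<beta>' + \<delta>")
    case True
    then obtain \<delta> where \<delta>: "\<alpha> = \<beta>' + \<delta>" by blast
    have "\<delta> \<noteq> exp_scale q \<gamma>'" for \<gamma>'
      using exp_division_unique[of q \<gamma> \<beta> \<gamma>' \<beta>'] that \<alpha> \<delta> \<beta> by (auto simp: add.commute)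
    then show ?thesis by (simp add: \<delta> lookup_single_mult_add lookup_frobenius(2)[OF pq])
  next
    case False
    then show ?thesis by (intro lookup_single_mult_eq_0) blast
  qed
  have "lookup (\<Sum>\<beta>\<in>?R. \<Sum>b\<in>B. single \<beta> b * frob_coord q (k b) \<beta> f ^ q) \<alpha>
      = (\<Sum>b\<in>B. lookup (single \<beta> b * frob_coord q (k b) \<beta> f ^ q) \<alpha>)"
    unfolding lookup_sum by (subst sum.remove[of _ \<beta>]) (use fin \<beta> other in \<open>auto simp: sum.neutral\<close>)
  also have "\<dots> = (\<Sum>b\<in>B. k b (lookup f \<alpha>) ^ q * b)" by (simp add: same)
  \<comment> \<open>The additional elements of \<open>B\<close> contribute \<open>0 ^ q * b\<close>,
    which is 0 as \<open>q\<close> is positive.\<close>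
  also have "\<dots> = (\<Sum>b | k b (lookup f \<alpha>) \<noteq> 0. k b (lookup f \<alpha>) ^ q * b)"
  proof (intro sum.mono_neutral_right finB ballI subsetI)
    fix b assume "b \<in> {b. k b (lookup f \<alpha>) \<noteq> 0}"
    moreover from this have "\<alpha> \<in> keys f" using k(1) by (auto simp: in_keys_iff)
    ultimately show "b \<in> B" by (auto simp: B_def)
  qed (use q in \<open>auto simp: power_0_left\<close>)
  finally show "lookup f \<alpha> = lookup (\<Sum>\<beta>\<in>?R. \<Sum>b\<in>B. single \<beta> b * frob_coord q (k b) \<beta> f ^ q) \<alpha>"
    using k(3) by simp
qed

text \<open>What later proofs use of the freeness of the polynomial ring over its q-th powers:
  linearity, coordinatewise membership in a Frobenius power, and division of exponents by
  \<open>q\<close>.\<close>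

theorem frobenius_coordinates:
  assumes pq: "prime CHAR('k::field)" "q = CHAR('k::field) ^ e"
  obtains \<Phi> :: "(('v::finite, 'k::field) mpoly \<Rightarrow> ('v, 'k) mpoly) set" where
    "\<And>\<phi> f g. \<phi> \<in> \<Phi> \<Longrightarrow> \<phi> (g ^ q * f) = g * \<phi> f"
    "\<And>L f. is_ideal L \<Longrightarrow> f \<in> frob_pow L q \<longleftrightarrow> (\<forall>\<phi>\<in>\<Phi>. \<phi> f \<in> L)"
    "\<And>\<phi> f \<gamma>. \<phi> \<in> \<Phi> \<Longrightarrow> \<gamma> \<in> keys (\<phi> f) \<Longrightarrow> \<exists>\<alpha>\<in>keys f. \<forall>v. q * lookup \<gamma> v \<le> lookup \<alpha> v"
proof -
  have q: "q > 0" using pq by (simp add: prime_gt_0_nat)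
  obtain k :: "'k \<Rightarrow> 'k \<Rightarrow> 'k" where k:
    "\<And>b x y. k b (x + y) = k b x + k b y"
    "\<And>b c x. k b (c ^ q * x) = c * k b x"
    "\<And>x. finite {b. k b x \<noteq> 0}"
    "\<And>x. (\<Sum>b | k b x \<noteq> 0. k b x ^ q * b) = x"
    using field_frobenius_coordinates[OF pq] by blast
  have k0: "k b 0 = 0" for b using k(1)[of b 0 0] by (metis add_0 add_cancel_right_right)
  define \<Phi> :: "(('v, 'k) mpoly \<Rightarrow> ('v, 'k) mpoly) set" where
    "\<Phi> = {frob_coord q (k b) \<beta> | b \<beta>. \<forall>v. lookup \<beta> v < q}"
  have lin: "\<phi> (g ^ q * f) = g * \<phi> f" "\<phi> (f + g) = \<phi> f + \<phi> g" if "\<phi> \<in> \<Phi>" for \<phi> f g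
    using that by (auto simp: \<Phi>_def frob_coord_semilinear[OF pq k(1,2)])
  show ?thesis
  proof
    show "f \<in> frob_pow L q \<longleftrightarrow> (\<forall>\<phi>\<in>\<Phi>. \<phi> f \<in> L)" if L: "is_ideal L" for L f
    proof
      assume f: "f \<in> frob_pow L q"
      \<comment> \<open>Quantifying over multipliers \<open>r\<close> makes this set an ideal, since
        the coordinates are linear only over q-th powers.\<close>
      have "is_ideal {f. \<forall>r. \<forall>\<phi>\<in>\<Phi>. \<phi> (r * f) \<in> L}"
      proof (rule is_idealI)
        have "\<phi> 0 \<in> L" if "\<phi> \<in> \<Phi>" for \<phi>
          using lin(2)[OF that, of 0 0] ideal_zero[OF L] by (metis add_0 add_cancel_right_right)
        then show "0 \<in> {f. \<forall>r. \<forall>\<phi>\<in>\<Phi>. \<phi> (r * f) \<in> L}" by simp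
      qed (auto simp: distrib_left lin(2) ideal_add[OF L] mult.assoc[symmetric])
      moreover have "\<phi> (r * x ^ q) \<in> L" if "x \<in> L" "\<phi> \<in> \<Phi>" for x r \<phi>
        using lin(1)[OF that(2), of x r] that(1) ideal_mult_right[OF L] by (simp add: mult.commute)
      ultimately have "frob_pow L q \<subseteq> {f. \<forall>r. \<forall>\<phi>\<in>\<Phi>. \<phi> (r * f) \<in> L}"
        by (auto simp: frob_pow_subset_iff)
      with f have "\<forall>r. \<forall>\<phi>\<in>\<Phi>. \<phi> (r * f) \<in> L" by blast
      then show "\<forall>\<phi>\<in>\<Phi>. \<phi> f \<in> L" by (metis mult_1)
    next
      assume "\<forall>\<phi>\<in>\<Phi>. \<phi> f \<in> L"
      then have "single \<beta> b * frob_coord q (k b) \<beta> f ^ q \<in> frob_pow L q"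
        if "\<forall>v. lookup \<beta> v < q" for \<beta> b
        using that by (intro ideal_mult_left power_in_frob_pow) (auto simp: \<Phi>_def)
      then show "f \<in> frob_pow L q"
        by (subst frob_coord_reconstruct[OF pq k0 k(3,4)]) (intro ideal_sum, auto)
    qed
    show "\<exists>\<alpha>\<in>keys f. \<forall>v. q * lookup \<gamma> v \<le> lookup \<alpha> v"
      if 1: "\<phi> \<in> \<Phi>" and 2: "\<gamma> \<in> keys (\<phi> f)" for \<phi> f \<gamma>
    proof -
      obtain b \<beta> where \<phi>: "\<phi> = frob_coord q (k b) \<beta>" using 1 by (auto simp: \<Phi>_def)
      then have "exp_scale q \<gamma> + \<beta> \<in> keys f"
        using 2 k0 q by (auto simp: in_keys_iff lookup_frob_coord)
      then show ?thesis by (rule bexI[rotated]) (simp add: lookup_add)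
    qed
  qed (rule lin)
qed

section \<open>Flatness of Frobenius\<close>

lemma frob_pow_powerD:
  fixes L :: "('v::finite, 'k::field) mpoly set"
  assumes pq: "prime CHAR('k)" "q = CHAR('k) ^ e" and L: "is_ideal L" and f: "f ^ q \<in> frob_pow L q"
  shows "f \<in> L"
proof -
  have q: "q > 0" using pq by (simp add: prime_gt_0_nat)
  obtain \<Phi> :: "(('v, 'k) mpoly \<Rightarrow> ('v, 'k) mpoly) set" where \<Phi>:
    "\<And>\<phi> f g. \<phi> \<in> \<Phi> \<Longrightarrow> \<phi> (g ^ q * f) = g * \<phi> f"
    "\<And>L f. is_ideal L \<Longrightarrow> f \<in> frob_pow L q \<longleftrightarrow> (\<forall>\<phi>\<in>\<Phi>. \<phi> f \<in> L)"
    using frobenius_coordinates[OF pq] by metis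
  \<comment> \<open>It suffices that \<open>1\<close> lies in the colon ideal \<open>M\<close>. Its
    Frobenius power contains \<open>1\<close>, since each
    \<open>\<phi> (f ^ q * 1) = f * \<phi> 1\<close> lies in \<open>L\<close>, and that power is
    contained in \<open>M\<close>.\<close>
  define M where "M = ideal_colon L {f}"
  have M: "is_ideal M" using L by (simp add: M_def is_ideal_ideal_colon)
  have "f * \<phi> 1 \<in> L" if "\<phi> \<in> \<Phi>" for \<phi>
    using \<Phi>(1)[OF that, of f 1] \<Phi>(2)[OF L] f that by auto
  then have "1 \<in> frob_pow M q"
    unfolding \<Phi>(2)[OF M] by (auto simp: M_def ideal_colon_def mult.commute)
  moreover have "frob_pow M q \<subseteq> M"
    using q M by (auto simp: frob_pow_subset_iff gr0_conv_Suc ideal_mult_right)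
  ultimately have "1 \<in> M" by blast
  then show ?thesis by (simp add: M_def ideal_colon_def)
qed

text \<open>The identity \<open>\<phi> (g ^ q * x) = g * \<phi> x\<close> turns the condition on
  \<open>x\<close> into membership of its coordinates in the colon ideal.\<close>

lemma frob_pow_colon:
  fixes L :: "('v::finite, 'k::field) mpoly set"
  assumes pq: "prime CHAR('k)" "q = CHAR('k) ^ e" and L: "is_ideal L"
    and x: "\<And>g. g \<in> a \<Longrightarrow> g ^ q * x \<in> frob_pow L q"
  shows "x \<in> frob_pow (ideal_colon L a) q"
proof -
  obtain \<Phi> :: "(('v, 'k) mpoly \<Rightarrow> ('v, 'k) mpoly) set" where \<Phi>:
    "\<And>\<phi> f g. \<phi> \<in> \<Phi> \<Longrightarrow> \<phi> (g ^ q * f) = g * \<phi> f"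
    "\<And>L f. is_ideal L \<Longrightarrow> f \<in> frob_pow L q \<longleftrightarrow> (\<forall>\<phi>\<in>\<Phi>. \<phi> f \<in> L)"
    using frobenius_coordinates[OF pq] by metis
  show ?thesis
    unfolding \<Phi>(2)[OF is_ideal_ideal_colon[OF L]]
  proof
    fix \<phi> assume "\<phi> \<in> \<Phi>"
    then have "g * \<phi> x \<in> L" if "g \<in> a" for g
      using x[OF that] \<Phi>(1)[of \<phi> g x] \<Phi>(2)[OF L] by auto
    then show "\<phi> x \<in> ideal_colon L a" by (simp add: ideal_colon_def mult.commute)
  qed
qed

lemma is_ideal_frobenius_vimage:
  fixes L :: "('v, 'k::field) mpoly set"
  assumes pq: "prime CHAR('k)" "q = CHAR('k) ^ e" and L: "is_ideal L"
  shows "is_ideal {x. x ^ q \<in> L}"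
proof -
  have "q > 0" using pq by (simp add: prime_gt_0_nat)
  then show ?thesis
    by (intro is_ideal_vimage[OF L])
       (simp_all add: mpoly_frobenius_add[OF pq] power_mult_distrib zero_power)
qed

text \<open>The elements whose q-th power lies in the right-hand side form an ideal by the
  freshman's dream, so only the generators \<open>x ^ r\<close> have to be tested.\<close>

lemma frob_pow_frob_pow:
  fixes L :: "('v, 'k::field) mpoly set"
  assumes pq: "prime CHAR('k)" "q = CHAR('k) ^ e"
  shows "frob_pow (frob_pow L r) q = frob_pow L (r * q)"
proof
  have "frob_pow L r \<subseteq> {x. x ^ q \<in> frob_pow L (r * q)}"
    by (subst frob_pow_subset_iff)
       (auto simp: is_ideal_frobenius_vimage[OF pq] power_mult[symmetric] power_in_frob_pow)
  then show "frob_pow (frob_pow L r) q \<subseteq> frob_pow L (r * q)"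
    by (auto simp: frob_pow_subset_iff)
  show "frob_pow L (r * q) \<subseteq> frob_pow (frob_pow L r) q"
    by (auto simp: frob_pow_subset_iff power_mult power_in_frob_pow)
qed

section \<open>Thresholds of a finitely generated ideal\<close>

text \<open>Closure under multiplication by \<open>p\<close> and under lowering by \<open>1\<close> moves the orbit
  \<open>p\<^sup>e t\<close> into a bounded, hence finite, part of \<open>T\<close> without changing it modulo the integers.\<close>

lemma rational_if_scaling_shift_closed:
  fixes T :: "real set" and p r :: nat
  assumes p: "p \<ge> 2" and scale: "\<And>t. t \<in> T \<Longrightarrow> real p * t \<in> T"
    and shift: "\<And>t. t \<in> T \<Longrightarrow> t > real r \<Longrightarrow> t - 1 \<in> T"
    and fin: "\<And>C :: nat. finite {t\<in>T. t \<le> real C}"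
    and t: "t \<in> T"
  shows "t \<in> \<rat>"
proof -
  \<comment> \<open>\<open>n\<close> bounds the excess of \<open>s\<close> over \<open>r\<close>, so
    each shift by 1 uses up one unit and the process ends at a value of at most
    \<open>r\<close>.\<close>
  have reduce: "\<exists>j::nat. s - real j \<in> T \<and> s - real j \<le> real r" if "s \<in> T" "s \<le> real (r + n)" for s n
    using that
  proof (induction n arbitrary: s)
    case 0
    then show ?case by (intro exI[of _ 0]) simp
  next
    case (Suc n)
    show ?case
    proof (cases "s > real r")
      case True
      then have "s - 1 \<in> T" "s - 1 \<le> real (r + n)" using Suc.prems shift by auto
      then obtain j :: nat where "s - 1 - real j \<in> T" "s - 1 - real j \<le> real r"
        using Suc.IH by blast
      then show ?thesis by (intro exI[of _ "Suc j"]) (simp add: algebra_simps)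
    next
      case False
      with Suc.prems show ?thesis by (intro exI[of _ 0]) simp
    qed
  qed
  have "real p ^ e * t \<in> T" for e
    by (induction e) (use t scale in \<open>auto simp: mult.assoc\<close>)
  moreover have "\<exists>n. real p ^ e * t \<le> real (r + n)" for e
    using real_arch_simple[of "real p ^ e * t - real r"] by (auto simp: algebra_simps)
  ultimately have "\<exists>j::nat. real p ^ e * t - real j \<in> T \<and> real p ^ e * t - real j \<le> real r" for e
    using reduce by blast
  then obtain j :: "nat \<Rightarrow> nat" where j: "\<And>e. real p ^ e * t - real (j e) \<in> {t\<in>T. t \<le> real r}"
    by (auto simp: choice_iff) metis
  have "\<not> inj (\<lambda>e. real p ^ e * t - real (j e))"
  proof
    assume "inj (\<lambda>e. real p ^ e * t - real (j e))"
    then have "infinite (range (\<lambda>e. real p ^ e * t - real (j e)))" by (auto dest: finite_imageD)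
    with j fin show False by (meson finite_subset image_subsetI)
  qed
  then obtain e e' where e: "e \<noteq> e'" "real p ^ e * t - real (j e) = real p ^ e' * t - real (j e')"
    by (auto simp: inj_def)
  then have "(real p ^ e - real p ^ e') * t = real (j e) - real (j e')"
    by (simp add: algebra_simps)
  moreover have "real p ^ e \<noteq> real p ^ e'" using e(1) p by simp
  ultimately have "t = (real (j e) - real (j e')) / (real p ^ e - real p ^ e')"
    by (simp add: field_simps)
  then show ?thesis by simp
qed

text \<open>The ideal generated by \<open>F\<close> stays fixed while \<open>L\<close> varies,
  because rationality comes from the set of thresholds of all \<open>L\<close> at once. Generators
  are fixed since their number enters the bounds.\<close>

locale frobenius_thresholds =
  fixes F :: "('v::finite, 'k::field) mpoly set" and p :: nat
  assumes finite_F: "finite F" and prime_p: "prime p" and CHAR_k: "CHAR('k) = p"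
begin

text \<open>\<open>Sup\<close> of the empty set of naturals is 0, so the unit ideal gets the value
  0. A value 0 therefore guarantees no witness and is treated separately below.\<close>

definition nu :: "('v, 'k) mpoly set \<Rightarrow> nat \<Rightarrow> nat" where
  "nu L q = Sup {m. \<not> ideal_pow (ideal_gen F) m \<subseteq> frob_pow L q}"

text \<open>The condition that the ideal generated by \<open>F\<close> lies in the radical of
  \<open>L\<close>, tested on generators.\<close>

definition admissible :: "('v, 'k) mpoly set \<Rightarrow> bool" where
  "admissible L \<longleftrightarrow> is_ideal L \<and> (\<forall>g\<in>F. \<exists>n. g ^ n \<in> L)"

definition thr :: "('v, 'k) mpoly set \<Rightarrow> real" where
  "thr L = lim (\<lambda>e. real (nu L (p ^ e)) / real (p ^ e))"

lemma char_facts: "prime CHAR('k)" "p ^ e = CHAR('k) ^ e" "p > 0" "p ^ e > 0"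
  using prime_p CHAR_k by (auto simp: prime_gt_0_nat)

text \<open>One exponent \<open>N\<close> puts all generators into \<open>L\<close>. By pigeonhole,
  a product of more than about \<open>card F * N * p ^ e\<close> generators contains some
  \<open>g ^ (N * p ^ e)\<close>, which lies in the Frobenius power. That \<open>C\<close> does not
  depend on \<open>e\<close> bounds the normalised values of \<open>nu\<close>.\<close>

lemma ideal_pow_subset_frob_pow:
  assumes "admissible L"
  obtains C where "\<And>e m. m \<ge> C * p ^ e \<Longrightarrow> ideal_pow (ideal_gen F) m \<subseteq> frob_pow L (p ^ e)"
proof -
  have L: "is_ideal L" and "\<forall>g\<in>F. \<exists>n. g ^ n \<in> L" using assms by (auto simp: admissible_def)
  then obtain n where n: "\<And>g. g \<in> F \<Longrightarrow> g ^ n g \<in> L" by metis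
  define N where "N = sum n F"
  have N: "g ^ N \<in> L" if "g \<in> F" for g
  proof -
    have "n g \<le> N" unfolding N_def using that finite_F by (intro member_le_sum) auto
    then have "g ^ N = g ^ (N - n g) * g ^ n g" by (simp add: power_add[symmetric])
    then show ?thesis using n[OF that] L by (simp add: ideal_mult_left)
  qed
  have "ideal_pow (ideal_gen F) m \<subseteq> frob_pow L (p ^ e)" if "m \<ge> (card F * N + 1) * p ^ e" for e m
  proof -
    have "card F * (N * p ^ e) < (card F * N + 1) * p ^ e"
      using char_facts(4)[of e] by (simp add: algebra_simps)
    then have "card F * (N * p ^ e) < m + card F" using that by linarith
    from ideal_pow_pigeonhole[OF finite_F this]
    show ?thesis
    proof (rule order_trans)
      show "ideal_gen {g ^ (N * p ^ e) * y |g y. g \<in> F \<and> y \<in> ideal_pow (ideal_gen F) (m - N * p ^ e)}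
          \<subseteq> frob_pow L (p ^ e)"
        by (subst ideal_gen_subset_iff)
           (auto simp: power_mult intro!: ideal_mult_right power_in_frob_pow N)
    qed
  qed
  then show ?thesis using that by blast
qed

lemma finite_nu_set:
  assumes "admissible L"
  shows "finite {m. \<not> ideal_pow (ideal_gen F) m \<subseteq> frob_pow L (p ^ e)}"
proof -
  obtain C where "\<And>e m. m \<ge> C * p ^ e \<Longrightarrow> ideal_pow (ideal_gen F) m \<subseteq> frob_pow L (p ^ e)"
    using ideal_pow_subset_frob_pow[OF assms] by blast
  then have "{m. \<not> ideal_pow (ideal_gen F) m \<subseteq> frob_pow L (p ^ e)} \<subseteq> {..C * p ^ e}"
    by (auto intro: leI less_imp_le)
  then show ?thesis by (rule finite_subset) simp
qed

lemma le_nu: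
  assumes "admissible L" "\<not> ideal_pow (ideal_gen F) m \<subseteq> frob_pow L (p ^ e)"
  shows "m \<le> nu L (p ^ e)"
  unfolding nu_def using assms finite_nu_set[OF assms(1)] by (intro cSup_upper) auto

text \<open>Powers decrease, so failure at the supremum gives failure at every smaller exponent;
  \<open>m > 0\<close> excludes the default supremum of the empty set.\<close>

lemma not_subset_if_le_nu:
  assumes L: "admissible L" and m: "m \<le> nu L (p ^ e)" "m > 0"
  shows "\<not> ideal_pow (ideal_gen F) m \<subseteq> frob_pow L (p ^ e)"
proof -
  let ?X = "{m. \<not> ideal_pow (ideal_gen F) m \<subseteq> frob_pow L (p ^ e)}"
  have ne: "?X \<noteq> {}" using m by (auto simp: nu_def Sup_nat_def split: if_splits)
  then have "nu L (p ^ e) = Max ?X"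
    unfolding nu_def Sup_nat_def by (rule if_not_P)
  then have "nu L (p ^ e) \<in> ?X" using Max_in[OF finite_nu_set[OF L] ne] by metis
  then show ?thesis using ideal_pow_antimono[OF m(1), of "ideal_gen F"] by blast
qed

text \<open>The p-th power of a witness is a witness one Frobenius level higher: by flatness,
  \<open>f ^ p\<close> in the p-th Frobenius power of an ideal would force \<open>f\<close> into
  that ideal.\<close>

lemma nu_Suc:
  assumes L: "admissible L"
  shows "p * nu L (p ^ e) \<le> nu L (p ^ Suc e)"
proof (cases "nu L (p ^ e) = 0")
  case False
  then obtain f where f: "f \<in> ideal_pow (ideal_gen F) (nu L (p ^ e))" "f \<notin> frob_pow L (p ^ e)"
    using not_subset_if_le_nu[OF L, of "nu L (p ^ e)" e] by auto
  have "f ^ p \<notin> frob_pow (frob_pow L (p ^ e)) p"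
    using f(2) frob_pow_powerD[OF char_facts(1), of p 1 "frob_pow L (p ^ e)" f] CHAR_k by auto
  then have "f ^ p \<notin> frob_pow L (p ^ Suc e)"
    using frob_pow_frob_pow[OF char_facts(1), of p 1 L "p ^ e"] CHAR_k by (simp add: mult.commute)
  moreover have "f ^ p \<in> ideal_pow (ideal_gen F) (p * nu L (p ^ e))"
    using f(1) by (rule ideal_pow_power_mem)
  ultimately show ?thesis by (intro le_nu[OF L]) blast
qed simp

text \<open>By \<open>nu_Suc\<close> the quotients increase and by
  \<open>ideal_pow_subset_frob_pow\<close> they are bounded, so the limit exists and bounds every
  term.\<close>

lemma thr_props:
  assumes L: "admissible L"
  shows thr_tendsto: "(\<lambda>e. real (nu L (p ^ e)) / real (p ^ e)) \<longlonglongrightarrow> thr L"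
    and nu_le_thr: "real (nu L (p ^ e)) / real (p ^ e) \<le> thr L"
proof -
  let ?X = "\<lambda>e. real (nu L (p ^ e)) / real (p ^ e)"
  have inc: "incseq ?X"
  proof (rule incseq_SucI)
    fix e
    have "real p * real (nu L (p ^ e)) \<le> real (nu L (p ^ Suc e))"
      using nu_Suc[OF L, of e] by (metis of_nat_le_iff of_nat_mult)
    then show "?X e \<le> ?X (Suc e)"
      using char_facts(3) by (simp add: field_simps)
  qed
  obtain C where C: "\<And>e m. m \<ge> C * p ^ e \<Longrightarrow> ideal_pow (ideal_gen F) m \<subseteq> frob_pow L (p ^ e)"
    using ideal_pow_subset_frob_pow[OF L] by blast
  have "?X e \<le> real C" for e
  proof -
    have "nu L (p ^ e) \<le> C * p ^ e"
      using not_subset_if_le_nu[OF L, of "nu L (p ^ e)" e] C[of e "nu L (p ^ e)"]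
      by (cases "nu L (p ^ e) = 0") (auto intro: leI less_imp_le)
    then have "real (nu L (p ^ e)) \<le> real C * real (p ^ e)" by (metis of_nat_le_iff of_nat_mult)
    then show ?thesis using char_facts(4)[of e] by (simp add: field_simps)
  qed
  then have "convergent ?X"
    using incseq_convergent[OF inc, of "real C"] convergentI by blast
  then show lim: "?X \<longlonglongrightarrow> thr L"
    by (simp add: thr_def convergent_LIMSEQ_iff)
  show "?X e \<le> thr L" using incseq_le[OF inc lim] .
qed

lemma thr_eqI:
  "(\<lambda>e. real (nu L (p ^ e)) / real (p ^ e)) \<longlonglongrightarrow> c \<Longrightarrow> thr L = c"
  by (simp add: thr_def limI)

section \<open>Effect of Frobenius powers and colon ideals on thresholds\<close>

lemma thr_frob_pow:
  assumes L: "admissible L"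
  shows "admissible (frob_pow L p)" "thr (frob_pow L p) = real p * thr L"
proof -
  show "admissible (frob_pow L p)"
    using L unfolding admissible_def by (metis is_ideal_frob_pow power_in_frob_pow power_mult)
  \<comment> \<open>The sequence for the Frobenius power is that of \<open>L\<close> shifted by one
    place, which multiplies the normalised limit by \<open>p\<close>.\<close>
  have "nu (frob_pow L p) (p ^ e) = nu L (p ^ Suc e)" for e
    by (simp add: nu_def frob_pow_frob_pow[OF char_facts(1,2)])
  moreover have "(\<lambda>e. real p * (real (nu L (p ^ Suc e)) / real (p ^ Suc e))) \<longlonglongrightarrow> real p * thr L"
    by (intro tendsto_mult_left LIMSEQ_Suc[OF thr_tendsto[OF L]])
  ultimately show "thr (frob_pow L p) = real p * thr L"
    using char_facts(3) by (intro thr_eqI) simp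
qed

text \<open>Left to right is flatness, as q-th powers of elements lie in the q-th power of the
  ideal. Right to left is the pigeonhole inclusion of a^m in a^[q] a^(m-q), for which
  \<open>m\<close> must be large.\<close>

lemma ideal_pow_colon_iff:
  assumes L: "is_ideal L" and m: "m \<ge> p ^ e" "card F * p ^ e < m + card F"
  shows "ideal_pow (ideal_gen F) m \<subseteq> frob_pow L (p ^ e) \<longleftrightarrow>
    ideal_pow (ideal_gen F) (m - p ^ e) \<subseteq> frob_pow (ideal_colon L (ideal_gen F)) (p ^ e)"
proof
  assume sub: "ideal_pow (ideal_gen F) m \<subseteq> frob_pow L (p ^ e)"
  show "ideal_pow (ideal_gen F) (m - p ^ e) \<subseteq> frob_pow (ideal_colon L (ideal_gen F)) (p ^ e)"
  proof
    fix x assume x: "x \<in> ideal_pow (ideal_gen F) (m - p ^ e)"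
    show "x \<in> frob_pow (ideal_colon L (ideal_gen F)) (p ^ e)"
    proof (rule frob_pow_colon[OF char_facts(1,2) L])
      fix g assume "g \<in> ideal_gen F"
      then have "g ^ (p ^ e) * x \<in> ideal_pow (ideal_gen F) (p ^ e + (m - p ^ e))"
        using x by (intro ideal_pow_mult_mem power_in_ideal_pow)
      then show "g ^ (p ^ e) * x \<in> frob_pow L (p ^ e)" using sub m(1) by auto
    qed
  qed
next
  assume sub: "ideal_pow (ideal_gen F) (m - p ^ e) \<subseteq> frob_pow (ideal_colon L (ideal_gen F)) (p ^ e)"
  have "g ^ (p ^ e) * y \<in> frob_pow L (p ^ e)"
    if g: "g \<in> F" and y: "y \<in> ideal_pow (ideal_gen F) (m - p ^ e)" for g y
  proof -
    have "frob_pow (ideal_colon L (ideal_gen F)) (p ^ e) \<subseteq> ideal_colon (frob_pow L (p ^ e)) {g ^ (p ^ e)}"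
    proof (subst frob_pow_subset_iff, intro is_ideal_ideal_colon is_ideal_frob_pow, intro ballI)
      fix x assume "x \<in> ideal_colon L (ideal_gen F)"
      then have "x * g \<in> L" using g by (auto simp: ideal_colon_def intro: ideal_gen_base)
      then have "(x * g) ^ (p ^ e) \<in> frob_pow L (p ^ e)" by (rule power_in_frob_pow)
      then show "x ^ p ^ e \<in> ideal_colon (frob_pow L (p ^ e)) {g ^ p ^ e}"
        by (simp add: ideal_colon_def power_mult_distrib)
    qed
    with sub y show ?thesis by (auto simp: ideal_colon_def mult.commute)
  qed
  then show "ideal_pow (ideal_gen F) m \<subseteq> frob_pow L (p ^ e)"
    using ideal_pow_pigeonhole[OF finite_F m(2)]
    by (elim order_trans) (auto simp: ideal_gen_subset_iff)
qed

text \<open>Once \<open>nu L q\<close> exceeds \<open>(card F + 1) * q\<close>, the colon criterion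
  applies at that exponent and at the next one. So \<open>nu M q = nu L q - q\<close> exactly, and
  the normalised values differ by 1.\<close>

lemma thr_colon:
  assumes L: "admissible L" and large: "thr L > real (card F + 1)"
  defines "M \<equiv> ideal_colon L (ideal_gen F)"
  shows "admissible M" "thr M = thr L - 1"
proof -
  have idL: "is_ideal L" using L by (simp add: admissible_def)
  show M: "admissible M"
    using L subset_ideal_colon[OF idL, of "ideal_gen F"] is_ideal_ideal_colon[OF idL]
    unfolding admissible_def M_def by blast
  have "\<forall>\<^sub>F e in sequentially. real (nu L (p ^ e)) / real (p ^ e) > real (card F + 1)"
    using order_tendstoD(1)[OF thr_tendsto[OF L] large] .
  then have ev: "\<forall>\<^sub>F e in sequentially.
      real (nu L (p ^ e)) / real (p ^ e) - 1 = real (nu M (p ^ e)) / real (p ^ e)"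
  proof eventually_elim
    case (elim e)
    let ?q = "p ^ e" and ?n = "nu L (p ^ e)"
    have q: "?q > 0" by (rule char_facts)
    have "real (card F + 1) * real ?q < real ?n" using elim q by (simp add: field_simps)
    then have n: "(card F + 1) * ?q < ?n" by (metis of_nat_less_iff of_nat_mult)
    \<comment> \<open>These give the two size conditions of
      \<open>ideal_pow_colon_iff\<close>.\<close>
    then have n': "?q < ?n" "card F * ?q < ?n" by auto
    have "\<not> ideal_pow (ideal_gen F) ?n \<subseteq> frob_pow L ?q"
      using n' by (intro not_subset_if_le_nu[OF L]) auto
    then have "\<not> ideal_pow (ideal_gen F) (?n - ?q) \<subseteq> frob_pow M ?q"
      unfolding M_def using n' by (subst ideal_pow_colon_iff[OF idL, symmetric]) auto
    then have "?n - ?q \<le> nu M ?q" by (rule le_nu[OF M])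
    moreover have "\<not> nu M ?q > ?n - ?q"
    proof
      assume "nu M ?q > ?n - ?q"
      then have "\<not> ideal_pow (ideal_gen F) (Suc ?n - ?q) \<subseteq> frob_pow M ?q"
        using n' by (intro not_subset_if_le_nu[OF M]) auto
      then have "\<not> ideal_pow (ideal_gen F) (Suc ?n) \<subseteq> frob_pow L ?q"
        unfolding M_def using n' by (subst ideal_pow_colon_iff[OF idL]) auto
      then show False using le_nu[OF L, of "Suc ?n" e] by simp
    qed
    ultimately have "nu M ?q = ?n - ?q" by simp
    then show ?case using n' q by (simp add: of_nat_diff diff_divide_distrib)
  qed
  have lim: "(\<lambda>e. real (nu L (p ^ e)) / real (p ^ e) - 1) \<longlonglongrightarrow> thr L - 1"
    by (intro tendsto_diff thr_tendsto[OF L] tendsto_const)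
  show "thr M = thr L - 1"
    by (rule thr_eqI[OF Lim_transform_eventually[OF lim ev]])
qed

section \<open>Finiteness of the thresholds below a bound\<close>

lemma power_products_keys_bound:
  assumes d: "\<And>g \<alpha> v. g \<in> F \<Longrightarrow> \<alpha> \<in> keys g \<Longrightarrow> lookup \<alpha> v \<le> d"
    and "x \<in> power_products F m" "\<alpha> \<in> keys x"
  shows "lookup \<alpha> v \<le> d * m"
  using assms(2,3)
proof (induction m arbitrary: x \<alpha>)
  case 0
  then show ?case using finite_F by (auto simp: power_products_def split: if_splits)
next
  case (Suc m)
  then obtain g y where gy: "x = g * y" "g \<in> F" "y \<in> power_products F m"
    by (auto simp: power_products_Suc[OF finite_F])
  then obtain \<beta> \<gamma> where "\<alpha> = \<beta> + \<gamma>" "\<beta> \<in> keys g" "\<gamma> \<in> keys y"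
    using Suc.prems(2) keys_mult[of g y] by blast
  then show ?case using d[OF gy(2)] Suc.IH[OF gy(3)] by (auto simp: lookup_add intro: add_mono)
qed

text \<open>The ideal \<open>coord_ideal\<close> is the smallest one whose \<open>q\<close>-th Frobenius power contains
  \<open>\<aa>\<^sup>m\<close>. It is generated in degree at most \<open>d m / q\<close>, so for bounded \<open>m / q\<close> strict inclusions
  among such ideals are seen in a fixed finite-dimensional space.\<close>

definition coord_ideal ::
  "(('v, 'k) mpoly \<Rightarrow> ('v, 'k) mpoly) set \<Rightarrow> nat \<Rightarrow> ('v, 'k) mpoly set" where
  "coord_ideal \<Phi> m = ideal_gen {\<phi> x | \<phi> x. \<phi> \<in> \<Phi> \<and> x \<in> ideal_pow (ideal_gen F) m}"

lemma coord_ideal_antimono: "m \<le> n \<Longrightarrow> coord_ideal \<Phi> n \<subseteq> coord_ideal \<Phi> m"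
  unfolding coord_ideal_def using ideal_pow_antimono[of m n "ideal_gen F"]
  by (intro ideal_gen_mono) auto

text \<open>Every finite set \<open>Z\<close> of such thresholds has at most
  \<open>card E + 1\<close> elements. At one common level \<open>q\<close> each \<open>z\<close>
  gets an exponent \<open>m z\<close> whose power lies in the Frobenius power of \<open>L z\<close>,
  while the powers belonging to smaller thresholds do not. The coordinate ideals of these powers
  then shrink strictly as \<open>z\<close> grows, visibly among polynomials with exponents in the
  box \<open>E\<close>.\<close>

lemma finite_thresholds: "finite {t \<in> thr ` Collect admissible. t \<le> real C}"
proof -
  have "finite (\<Union>g\<in>F. \<Union>\<alpha>\<in>keys g. range (lookup \<alpha>))" using finite_F by simp
  then obtain d where "\<forall>n\<in>(\<Union>g\<in>F. \<Union>\<alpha>\<in>keys g. range (lookup \<alpha>)). n \<le> d"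
    by (meson finite_nat_set_iff_bounded_le)
  then have d: "lookup \<alpha> v \<le> d" if "g \<in> F" "\<alpha> \<in> keys g" for g \<alpha> v
    using that by blast
  \<comment> \<open>Generators of the m-th power have exponent entries at most \<open>d * m\<close>;
    with \<open>m \<le> (C + 1) * q\<close>, division by \<open>q\<close> leaves
    \<open>d * (C + 1)\<close>.\<close>
  define E where "E = {\<alpha> :: 'v \<Rightarrow>\<^sub>0 nat. \<forall>v. lookup \<alpha> v \<le> d * (C + 1)}"
  have finE: "finite E" unfolding E_def by (rule finite_bounded_exponents)
  have "card Z \<le> card {..card E}" if Z: "Z \<subseteq> {t \<in> thr ` Collect admissible. t \<le> real C}" "finite Z" for Z
  proof -
    have "\<forall>z\<in>Z. \<exists>L. admissible L \<and> thr L = z" using Z(1) by auto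
    then obtain L where L: "\<And>z. z \<in> Z \<Longrightarrow> admissible (L z)" "\<And>z. z \<in> Z \<Longrightarrow> thr (L z) = z" by metis
    have idL: "is_ideal (L z)" if "z \<in> Z" for z using L(1)[OF that] by (simp add: admissible_def)
    have inv0: "(\<lambda>e. inverse (real p ^ e)) \<longlonglongrightarrow> 0"
      using prime_gt_1_nat[OF prime_p] by (intro LIMSEQ_inverse_realpow_zero) simp
    \<comment> \<open>The term \<open>inverse (real p ^ e)\<close> pays for rounding:
      \<open>z' * real q + 1\<close>, an upper bound for \<open>m z'\<close>, must still be below
      \<open>nu (L z) q\<close>.\<close>
    have ev: "\<forall>\<^sub>F e in sequentially. z' < z \<longrightarrow> real (nu (L z) (p ^ e)) / real (p ^ e) - inverse (real p ^ e) > z'"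
      if "z \<in> Z" for z z'
    proof (cases "z' < z")
      case True
      have "(\<lambda>e. real (nu (L z) (p ^ e)) / real (p ^ e) - inverse (real p ^ e)) \<longlonglongrightarrow> z - 0"
        using thr_tendsto[OF L(1)[OF that]] L(2)[OF that] by (intro tendsto_diff inv0) simp
      then show ?thesis using True order_tendstoD(1)[of _ "z - 0"] by fastforce
    qed simp
    have "\<forall>\<^sub>F e in sequentially. \<forall>z\<in>Z. \<forall>z'\<in>Z. z' < z \<longrightarrow>
        real (nu (L z) (p ^ e)) / real (p ^ e) - inverse (real p ^ e) > z'"
      by (intro eventually_ball_finite[OF Z(2)] ballI ev)
    then obtain e where e: "\<And>z z'. z \<in> Z \<Longrightarrow> z' \<in> Z \<Longrightarrow> z' < z \<Longrightarrow>
        real (nu (L z) (p ^ e)) / real (p ^ e) - inverse (real p ^ e) > z'"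
      by (auto simp: eventually_sequentially)
    define q where "q = p ^ e"
    have q: "q > 0" unfolding q_def by (rule char_facts)
    \<comment> \<open>For \<open>z \<ge> 0\<close> this is the least natural number strictly above
      \<open>z * real q\<close>. It exceeds \<open>nu (L z) q\<close> because normalised values
      never exceed their limit.\<close>
    define m where "m z = Suc (nat \<lfloor>z * real q\<rfloor>)" for z
    have pos: "z \<ge> 0" if "z \<in> Z" for z
      using nu_le_thr[OF L(1)[OF that], of e] L(2)[OF that] by (metis divide_nonneg_nonneg of_nat_0_le_iff order_trans)
    have m_gt: "z * real q < real (m z)" and m_le: "real (m z) \<le> z * real q + 1" if "z \<in> Z" for z
      using pos[OF that] by (simp_all add: m_def) linarith+
    have m_mono: "m z' \<le> m z" if "z' \<le> z" for z z'
      using that unfolding m_def by (intro Suc_le_mono[THEN iffD2] nat_mono floor_mono mult_right_mono) auto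
    have m_bound: "m z \<le> (C + 1) * q" if "z \<in> Z" for z
    proof -
      have "z \<le> real C" using Z(1) that by auto
      then have "z * real q \<le> real C * real q" by (intro mult_right_mono) auto
      then have "real (m z) \<le> real (C * q + 1)" using m_le[OF that] by simp
      then have "m z \<le> C * q + 1" by linarith
      then show ?thesis using q by simp
    qed
    have below: "ideal_pow (ideal_gen F) (m z) \<subseteq> frob_pow (L z) q" if "z \<in> Z" for z
    proof (rule ccontr)
      assume "\<not> ?thesis"
      then have "m z \<le> nu (L z) q" unfolding q_def by (rule le_nu[OF L(1)[OF that]])
      moreover have "real (nu (L z) q) \<le> z * real q"
        using nu_le_thr[OF L(1)[OF that], of e] L(2)[OF that] q by (simp add: q_def field_simps)
      ultimately show False using m_gt[OF that] by linarith
    qed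
    have above: "\<not> ideal_pow (ideal_gen F) (m z') \<subseteq> frob_pow (L z) q" if "z \<in> Z" "z' \<in> Z" "z' < z" for z z'
    proof -
      have "z' < (real (nu (L z) q) - 1) / real q"
        using e[OF that] by (simp add: q_def diff_divide_distrib inverse_eq_divide)
      then have "z' * real q + 1 < real (nu (L z) q)"
        using q by (simp add: pos_less_divide_eq)
      then have "m z' \<le> nu (L z) q" using m_le[OF that(2)] by linarith
      then show ?thesis unfolding q_def using that by (intro not_subset_if_le_nu L) (auto simp: m_def)
    qed
    obtain \<Phi> :: "(('v, 'k) mpoly \<Rightarrow> ('v, 'k) mpoly) set" where \<Phi>:
      "\<And>L f. is_ideal L \<Longrightarrow> f \<in> frob_pow L q \<longleftrightarrow> (\<forall>\<phi>\<in>\<Phi>. \<phi> f \<in> L)"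
      "\<And>\<phi> f \<gamma>. \<phi> \<in> \<Phi> \<Longrightarrow> \<gamma> \<in> keys (\<phi> f) \<Longrightarrow> \<exists>\<alpha>\<in>keys f. \<forall>v. q * lookup \<gamma> v \<le> lookup \<alpha> v"
      using frobenius_coordinates[OF char_facts(1,2), of e] unfolding q_def by metis
    define V where "V z = coord_ideal \<Phi> (m z) \<inter> {f. keys f \<subseteq> E}" for z
    have V_closed: "0 \<in> V z" "f \<in> V z \<Longrightarrow> g \<in> V z \<Longrightarrow> f + g \<in> V z"
        "f \<in> V z \<Longrightarrow> g \<in> V z \<Longrightarrow> f - g \<in> V z" "g \<in> V z \<Longrightarrow> single 0 c * g \<in> V z" for f g c z
    proof -
      have "is_ideal (coord_ideal \<Phi> (m z))" by (simp add: coord_ideal_def)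
      note * = ideal_zero[OF this] ideal_add[OF this] ideal_diff[OF this] ideal_mult_left[OF this]
      have k: "keys (f + g) \<subseteq> keys f \<union> keys g" "keys (f - g) \<subseteq> keys f \<union> keys g"
          "keys (single 0 c * g) \<subseteq> keys g"
        by (auto simp: in_keys_iff lookup_add lookup_minus)
      show "0 \<in> V z" using *(1) by (simp add: V_def)
      show "f \<in> V z \<Longrightarrow> g \<in> V z \<Longrightarrow> f + g \<in> V z" using *(2) k(1) unfolding V_def by blast
      show "f \<in> V z \<Longrightarrow> g \<in> V z \<Longrightarrow> f - g \<in> V z" using *(3) k(2) unfolding V_def by blast
      show "g \<in> V z \<Longrightarrow> single 0 c * g \<in> V z" using *(4) k(3) unfolding V_def by blast
    qed
    have V_mono: "V z \<subseteq> V z'" if "z' \<le> z" for z z'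
      using coord_ideal_antimono[OF m_mono[OF that]] by (auto simp: V_def)
    have V_sub: "V z \<subseteq> L z" if "z \<in> Z" for z
    proof -
      have "coord_ideal \<Phi> (m z) \<subseteq> L z"
        using below[OF that] \<Phi>(1)[OF idL[OF that]] idL[OF that]
        by (auto simp: coord_ideal_def ideal_gen_subset_iff)
      then show ?thesis by (auto simp: V_def)
    qed
    \<comment> \<open>The generators of the power of order \<open>m z'\<close> have coordinates
      supported in \<open>E\<close>. If these all lay in \<open>L z\<close>, the whole power would
      lie in the Frobenius power of \<open>L z\<close>, contrary to \<open>above\<close>.\<close>
    have V_not_sub: "\<not> V z' \<subseteq> L z" if z: "z \<in> Z" "z' \<in> Z" "z' < z" for z z'
    proof
      assume sub: "V z' \<subseteq> L z"
      have "x \<in> frob_pow (L z) q" if x: "x \<in> power_products F (m z')" for x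
        unfolding \<Phi>(1)[OF idL[OF z(1)]]
      proof
        fix \<phi> assume \<phi>: "\<phi> \<in> \<Phi>"
        have "x \<in> ideal_pow (ideal_gen F) (m z')"
          using x by (simp add: ideal_pow_ideal_gen[OF finite_F] ideal_gen_base)
        then have "\<phi> x \<in> coord_ideal \<Phi> (m z')"
          unfolding coord_ideal_def using \<phi> by (intro ideal_gen_base) blast
        moreover have "keys (\<phi> x) \<subseteq> E"
        proof
          fix \<gamma> assume "\<gamma> \<in> keys (\<phi> x)"
          then obtain \<alpha> where \<alpha>: "\<alpha> \<in> keys x" "\<forall>v. q * lookup \<gamma> v \<le> lookup \<alpha> v"
            using \<Phi>(2)[OF \<phi>] by blast
          have "lookup \<gamma> v \<le> d * (C + 1)" for v
          proof -
            have "lookup \<alpha> v \<le> d * m z'"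
              by (rule power_products_keys_bound[OF _ x \<alpha>(1)]) (rule d)
            then have "q * lookup \<gamma> v \<le> d * m z'"
              using \<alpha>(2) by (meson order_trans)
            also have "\<dots> \<le> d * ((C + 1) * q)" using m_bound[OF z(2)] by (rule mult_le_mono2)
            finally have "q * lookup \<gamma> v \<le> q * (d * (C + 1))" by (simp only: mult_ac)
            then show ?thesis using q by (metis mult_le_cancel1)
          qed
          then show "\<gamma> \<in> E" by (simp add: E_def)
        qed
        ultimately have "\<phi> x \<in> V z'" by (simp add: V_def)
        then show "\<phi> x \<in> L z" using sub by blast
      qed
      then have "ideal_pow (ideal_gen F) (m z') \<subseteq> frob_pow (L z) q"
        by (auto simp: ideal_pow_ideal_gen[OF finite_F] ideal_gen_subset_iff)
      with above[OF z] show False by blast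
    qed
    \<comment> \<open>The number of leading exponents plays the role of the dimension of
      \<open>V z\<close>: nested spaces with the same leads coincide.\<close>
    define l where "l z = lead ` (V z - {0})" for z
    have l_E: "l z \<subseteq> E" for z
      using lead_in_keys by (force simp: l_def V_def)
    have "card (l z) < card (l z')" if z: "z \<in> Z" "z' \<in> Z" "z' < z" for z z'
    proof (rule psubset_card_mono)
      show "finite (l z')" using l_E finE by (rule finite_subset)
      have "l z \<subseteq> l z'" using V_mono[of z' z] z by (auto simp: l_def)
      moreover have "\<not> l z' \<subseteq> l z"
      proof
        assume sub: "l z' \<subseteq> l z"
        have "V z' \<subseteq> V z"
        proof (rule subset_by_leads)
          show "\<exists>g\<in>V z. g \<noteq> 0 \<and> lead g = lead f" if "f \<in> V z'" "f \<noteq> 0" for f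
          proof -
            have "lead f \<in> l z" using that sub by (auto simp: l_def)
            then show ?thesis by (auto simp: l_def)
          qed
        qed (use V_mono[of z' z] z V_closed in auto)
        then show False using V_sub[OF z(1)] V_not_sub[OF z] by blast
      qed
      ultimately show "l z \<subset> l z'" by blast
    qed
    then have "inj_on (\<lambda>z. card (l z)) Z"
      by (intro linorder_inj_onI') (metis less_irrefl)
    moreover have "(\<lambda>z. card (l z)) ` Z \<subseteq> {..card E}"
      using card_mono[OF finE l_E] by auto
    ultimately show ?thesis by (intro card_inj_on_le) auto
  qed
  then show ?thesis using finite_if_finite_subsets_card_bdd by blast
qed

text \<open>The set of all thresholds is stable under multiplication by \<open>p\<close> through
  Frobenius powers, and under lowering by 1 above \<open>card F + 1\<close> through colon ideals;
  its bounded parts are finite.\<close>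

theorem thr_rational:
  assumes "admissible L"
  shows "thr L \<in> \<rat>"
proof (rule rational_if_scaling_shift_closed)
  show "p \<ge> 2" using prime_p by (rule prime_ge_2_nat)
  show "thr L \<in> thr ` Collect admissible" using assms by blast
  show "real p * t \<in> thr ` Collect admissible" if "t \<in> thr ` Collect admissible" for t
    using that by (auto simp: thr_frob_pow(2)[symmetric] intro: thr_frob_pow)
  show "t - 1 \<in> thr ` Collect admissible"
    if t: "t \<in> thr ` Collect admissible" "t > real (card F + 1)" for t
  proof -
    obtain L where "t = thr L" "admissible L" using t(1) by blast
    then show ?thesis using thr_colon[of L] t(2) by (metis imageI mem_Collect_eq)
  qed
qed (rule finite_thresholds)

end

section \<open>Monomial ideals\<close>

definition exps_above :: "('v \<Rightarrow>\<^sub>0 nat) set \<Rightarrow> ('v \<Rightarrow>\<^sub>0 nat) set" where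
  "exps_above D = {\<alpha>. \<exists>\<epsilon>\<in>D. \<exists>\<delta>. \<alpha> = \<epsilon> + \<delta>}"

lemma exps_above_iff: "\<alpha> \<in> exps_above D \<longleftrightarrow> (\<exists>\<epsilon>\<in>D. \<forall>v. lookup \<epsilon> v \<le> lookup \<alpha> v)"
  by (simp add: exps_above_def exp_dvd_iff)

text \<open>A monomial ideal is spanned by its monomials, so questions about it become questions
  about upward closed sets of exponents, where sums of ideals are unions.\<close>

lemma mem_monomial_ideal_iff:
  fixes f :: "('v, 'k::comm_ring_1) mpoly"
  shows "f \<in> ideal_gen (monomial_poly ` D) \<longleftrightarrow> keys f \<subseteq> exps_above D"
proof
  let ?I = "{f :: ('v, 'k) mpoly. keys f \<subseteq> exps_above D}"
  have "is_ideal ?I"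
  proof (rule is_idealI)
    show "f + g \<in> ?I" if "f \<in> ?I" "g \<in> ?I" for f g
      using that keys_add[of f g] by auto
    show "r * f \<in> ?I" if f: "f \<in> ?I" for r f
    proof (rule CollectI, rule subsetI)
      fix \<alpha> assume "\<alpha> \<in> keys (r * f)"
      then obtain \<beta> \<gamma> where "\<alpha> = \<beta> + \<gamma>" "\<gamma> \<in> keys f" using keys_mult[of r f] by blast
      moreover then obtain \<epsilon> \<delta> where "\<epsilon> \<in> D" "\<gamma> = \<epsilon> + \<delta>" using f by (auto simp: exps_above_def)
      ultimately show "\<alpha> \<in> exps_above D"
        unfolding exps_above_def by (metis (mono_tags, lifting) add.left_commute mem_Collect_eq)
    qed
  qed simp
  moreover have "monomial_poly \<epsilon> \<in> ?I" if "\<epsilon> \<in> D" for \<epsilon>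
    using that by (auto simp: monomial_poly_def exps_above_iff split: if_splits)
  ultimately have "ideal_gen (monomial_poly ` D) \<subseteq> ?I"
    by (auto simp: ideal_gen_subset_iff)
  then show "f \<in> ideal_gen (monomial_poly ` D) \<Longrightarrow> keys f \<subseteq> exps_above D" by blast
next
  assume f: "keys f \<subseteq> exps_above D"
  have "single \<alpha> (lookup f \<alpha>) \<in> ideal_gen (monomial_poly ` D)" if \<alpha>: "\<alpha> \<in> keys f" for \<alpha>
  proof -
    obtain \<epsilon> \<delta> where \<epsilon>: "\<epsilon> \<in> D" "\<alpha> = \<epsilon> + \<delta>" using f \<alpha> by (auto simp: exps_above_def)
    then have "single \<alpha> (lookup f \<alpha>) = single \<delta> (lookup f \<alpha>) * monomial_poly \<epsilon>"
      by (simp add: monomial_poly_def mult_single add.commute)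
    then show ?thesis using \<epsilon>(1) by (simp add: ideal_mult_left ideal_gen_base)
  qed
  then show "f \<in> ideal_gen (monomial_poly ` D)"
    by (subst poly_mapping_eq_sum_single) (rule ideal_sum, simp)
qed

lemma ideal_gen_Un_ideal_gen: "ideal_gen (G \<union> ideal_gen H) = ideal_gen (G \<union> H)"
proof
  show "ideal_gen (G \<union> ideal_gen H) \<subseteq> ideal_gen (G \<union> H)"
    using ideal_gen_mono[of H "G \<union> H"] ideal_gen_superset[of "G \<union> H"]
    by (simp add: ideal_gen_subset_iff)
  show "ideal_gen (G \<union> H) \<subseteq> ideal_gen (G \<union> ideal_gen H)"
    using ideal_gen_superset[of H] by (intro ideal_gen_mono) auto
qed

lemma ideal_gen_Un_ideal_gens: "ideal_gen (ideal_gen G \<union> ideal_gen H) = ideal_gen (G \<union> H)"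
  by (metis Un_commute ideal_gen_Un_ideal_gen)

lemma frob_pow_monomial_ideal:
  fixes D :: "('v \<Rightarrow>\<^sub>0 nat) set"
  assumes pq: "prime CHAR('k::field)" "q = CHAR('k::field) ^ e"
  shows "frob_pow (ideal_gen (monomial_poly ` D)) q
    = (ideal_gen (monomial_poly ` exp_scale q ` D) :: ('v, 'k::field) mpoly set)" (is "?L = ?R")
proof
  have pow: "monomial_poly \<epsilon> ^ q = (monomial_poly (exp_scale q \<epsilon>) :: ('v, 'k) mpoly)" for \<epsilon>
    by (simp add: monomial_poly_def single_power)
  have "ideal_gen (monomial_poly ` D) \<subseteq> {x. x ^ q \<in> ?R}"
    by (subst ideal_gen_subset_iff)
       (auto simp: is_ideal_frobenius_vimage[OF pq] pow intro!: ideal_gen_base)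
  then show "?L \<subseteq> ?R" by (auto simp: frob_pow_subset_iff)
  have "monomial_poly (exp_scale q \<epsilon>) \<in> ?L" if "\<epsilon> \<in> D" for \<epsilon>
    unfolding pow[symmetric] using that by (intro power_in_frob_pow ideal_gen_base) auto
  then show "?R \<subseteq> ?L" by (auto simp: ideal_gen_subset_iff)
qed

lemma mem_frob_pow_sum_monomial_iff:
  fixes D E :: "('v \<Rightarrow>\<^sub>0 nat) set" and f :: "('v, 'k::field) mpoly"
  assumes pq: "prime CHAR('k)" "q = CHAR('k) ^ e"
  shows "f \<in> ideal_gen (frob_pow (ideal_gen (monomial_poly ` D)) q \<union> ideal_gen (monomial_poly ` E))
    \<longleftrightarrow> keys f \<subseteq> exps_above (exp_scale q ` D) \<union> exps_above E"
proof -
  have "ideal_gen (frob_pow (ideal_gen (monomial_poly ` D)) q \<union> ideal_gen (monomial_poly ` E))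
      = (ideal_gen (monomial_poly ` (exp_scale q ` D \<union> E)) :: ('v, 'k) mpoly set)"
    by (simp add: frob_pow_monomial_ideal[OF pq] ideal_gen_Un_ideal_gens image_Un)
  moreover have "exps_above (exp_scale q ` D \<union> E) = exps_above (exp_scale q ` D) \<union> exps_above E"
    by (auto simp: exps_above_def)
  ultimately show ?thesis by (simp only: mem_monomial_ideal_iff)
qed

subsection \<open>Ideals generated by variables\<close>

definition var_exps :: "'v set \<Rightarrow> ('v \<Rightarrow>\<^sub>0 nat) set" where
  "var_exps A = (\<lambda>v. single v 1) ` A"

definition var_ideal :: "'v set \<Rightarrow> ('v, 'k::comm_ring_1) mpoly set" where
  "var_ideal A = ideal_gen (monomial_poly ` var_exps A)"

lemma exps_above_var_exps: "exps_above (var_exps A) = {\<alpha>. \<exists>v\<in>A. lookup \<alpha> v > 0}"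
  by (auto simp: exps_above_iff var_exps_def lookup_single when_def Suc_le_eq split: if_splits)

lemma mem_var_ideal_iff: "f \<in> var_ideal A \<longleftrightarrow> (\<forall>\<alpha>\<in>keys f. \<exists>v\<in>A. lookup \<alpha> v > 0)"
  by (auto simp: var_ideal_def mem_monomial_ideal_iff exps_above_var_exps)

lemma is_ideal_var_ideal: "is_ideal (var_ideal A)"
  by (simp add: var_ideal_def)

text \<open>Setting the variables in \<open>A\<close> to zero is a ring endomorphism with kernel
  \<open>var_ideal A\<close>; it models the quotient by that ideal without changing the polynomial
  ring.\<close>

definition kill_vars :: "'v set \<Rightarrow> ('v, 'k::comm_ring_1) mpoly \<Rightarrow> ('v, 'k) mpoly" where
  "kill_vars A f = (\<Sum>\<alpha>\<in>{\<alpha>\<in>keys f. \<forall>v\<in>A. lookup \<alpha> v = 0}. single \<alpha> (lookup f \<alpha>))"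

lemma lookup_kill_vars:
  "lookup (kill_vars A f) \<alpha> = (if \<forall>v\<in>A. lookup \<alpha> v = 0 then lookup f \<alpha> else 0)"
  by (auto simp: kill_vars_def lookup_sum lookup_single when_def in_keys_iff)

lemma keys_kill_vars: "keys (kill_vars A f) = {\<alpha>\<in>keys f. \<forall>v\<in>A. lookup \<alpha> v = 0}"
  by (auto simp: in_keys_iff lookup_kill_vars split: if_splits)

lemma kill_vars_add: "kill_vars A (f + g) = kill_vars A f + kill_vars A g"
  by (rule poly_mapping_eqI) (simp add: lookup_kill_vars lookup_add)

lemma kill_vars_eq_0_iff: "kill_vars A f = 0 \<longleftrightarrow> f \<in> var_ideal A"
  by (subst keys_eq_empty[symmetric]) (auto simp: keys_kill_vars mem_var_ideal_iff)

lemma kill_vars_id: "(\<And>\<alpha> v. \<alpha> \<in> keys f \<Longrightarrow> v \<in> A \<Longrightarrow> lookup \<alpha> v = 0) \<Longrightarrow> kill_vars A f = f"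
  by (rule poly_mapping_eqI) (metis lookup_kill_vars in_keys_iff)

lemma kill_vars_0: "kill_vars A 0 = 0" and kill_vars_1: "kill_vars A 1 = 1"
  by (rule kill_vars_id; auto simp: keys_one split: if_splits)+

lemma diff_kill_vars: "f - kill_vars A f \<in> var_ideal A"
  by (auto simp: mem_var_ideal_iff in_keys_iff lookup_minus lookup_kill_vars split: if_splits)

text \<open>Discarding terms changes \<open>f\<close> and \<open>g\<close> only by elements of
  \<open>var_ideal A\<close>, and a product of polynomials free of the variables in \<open>A\<close>
  is again free of them.\<close>

lemma kill_vars_mult: "kill_vars A (f * g) = kill_vars A f * kill_vars A g"
proof -
  let ?k = "kill_vars A"
  have "f * g = ?k f * ?k g + (?k f * (g - ?k g) + (f - ?k f) * g)"
    by (simp add: algebra_simps)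
  moreover have "?k f * (g - ?k g) + (f - ?k f) * g \<in> var_ideal A"
    by (intro ideal_add[OF is_ideal_var_ideal] ideal_mult_left[OF is_ideal_var_ideal]
        ideal_mult_right[OF is_ideal_var_ideal] diff_kill_vars)
  ultimately have "?k (f * g) = ?k (?k f * ?k g)"
    by (metis kill_vars_add kill_vars_eq_0_iff add.right_neutral)
  also have "\<dots> = ?k f * ?k g"
  proof (rule kill_vars_id)
    fix \<alpha> v assume \<alpha>: "\<alpha> \<in> keys (?k f * ?k g)" "v \<in> A"
    then obtain \<beta> \<gamma> where "\<alpha> = \<beta> + \<gamma>" "\<beta> \<in> keys (?k f)" "\<gamma> \<in> keys (?k g)"
      using keys_mult[of "?k f" "?k g"] by blast
    with \<alpha>(2) show "lookup \<alpha> v = 0" by (simp add: keys_kill_vars lookup_add)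
  qed
  finally show ?thesis .
qed

lemma kill_vars_power: "kill_vars A (f ^ n) = kill_vars A f ^ n"
  by (induction n) (simp_all add: kill_vars_1 kill_vars_mult)

text \<open>It is the kernel of a ring homomorphism into an integral domain.\<close>

lemma prime_ideal_var_ideal: "prime_ideal (var_ideal A :: ('v::finite, 'k::field) mpoly set)"
proof -
  have "1 \<notin> (var_ideal A :: ('v, 'k) mpoly set)"
    by (simp add: kill_vars_eq_0_iff[symmetric] kill_vars_1)
  moreover have "f \<in> var_ideal A \<or> g \<in> var_ideal A" if "f * g \<in> var_ideal A" for f g :: "('v, 'k) mpoly"
    using that mpoly_mult_nonzero by (auto simp: kill_vars_eq_0_iff[symmetric] kill_vars_mult)
  ultimately show ?thesis
    by (auto simp: prime_ideal_def is_ideal_var_ideal)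
qed

subsection \<open>Minimal primes of squarefree monomial ideals\<close>

text \<open>With the supports of the exponents as hyperedges these are vertex covers; the minimal
  ones correspond to the minimal primes.\<close>

definition covers :: "('v \<Rightarrow>\<^sub>0 nat) set \<Rightarrow> 'v set set" where
  "covers E = {A. \<forall>\<epsilon>\<in>E. \<exists>v\<in>A. lookup \<epsilon> v > 0}"

lemma subset_var_ideal_iff:
  "(ideal_gen (monomial_poly ` E) :: ('v, 'k::field) mpoly set) \<subseteq> var_ideal A \<longleftrightarrow> A \<in> covers E"
  by (auto simp: ideal_gen_subset_iff is_ideal_var_ideal mem_var_ideal_iff covers_def monomial_poly_def)

lemma var_ideal_subset_iff:
  "(var_ideal A :: ('v, 'k::field) mpoly set) \<subseteq> var_ideal B \<longleftrightarrow> A \<subseteq> B"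
  unfolding var_ideal_def[of A] subset_var_ideal_iff
  by (auto simp: covers_def var_exps_def lookup_single when_def split: if_splits)

text \<open>Split off one variable at a time and use primality; the process stops before the
  monomial 1, which a proper ideal does not contain.\<close>

lemma prime_ideal_monomial:
  fixes Q :: "('v::finite, 'k::field) mpoly set"
  assumes Q: "prime_ideal Q" and "monomial_poly \<alpha> \<in> Q"
  shows "\<exists>v. lookup \<alpha> v > 0 \<and> monomial_poly (single v 1) \<in> Q"
  using assms(2)
proof (induction "exp_code \<alpha>" arbitrary: \<alpha> rule: less_induct)
  case less
  have idQ: "is_ideal Q" "Q \<noteq> UNIV" using Q by (auto simp: prime_ideal_def)
  have "\<alpha> \<noteq> 0"
  proof
    assume "\<alpha> = 0"
    then have "1 \<in> Q" using less.prems by (simp add: monomial_poly_def)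
    then have "x \<in> Q" for x using ideal_mult_left[OF idQ(1), of 1 x] by simp
    with idQ(2) show False by blast
  qed
  then obtain v where v: "lookup \<alpha> v > 0" by (metis gr0I lookup_zero poly_mapping_eqI)
  then have "\<forall>w. lookup (single v (1::nat)) w \<le> lookup \<alpha> w"
    by (auto simp: lookup_single when_def)
  then obtain \<beta> where \<beta>: "\<alpha> = single v 1 + \<beta>" using exp_dvd_iff[of \<alpha> "single v 1"] by blast
  then have "monomial_poly (single v 1) * monomial_poly \<beta> \<in> Q"
    using less.prems by (simp add: monomial_poly_def mult_single)
  then consider "monomial_poly (single v 1) \<in> Q" | "monomial_poly \<beta> \<in> Q"
    using Q by (auto simp: prime_ideal_def)
  then show ?case
  proof cases
    case 2
    have "exp_code \<beta> < exp_code \<alpha>"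
    proof -
      have "exp_code \<beta> \<le> exp_code \<alpha>" using exp_code_pos[of "single v (1::nat)"] by (simp add: \<beta> exp_code_add)
      moreover have "lookup \<alpha> v = Suc (lookup \<beta> v)" by (simp add: \<beta> lookup_add)
      then have "\<beta> \<noteq> \<alpha>" by auto
      ultimately show ?thesis using inj_exp_code[of \<beta> \<alpha>] by fastforce
    qed
    then obtain w where "lookup \<beta> w > 0" "monomial_poly (single w 1) \<in> Q"
      using less.hyps 2 by blast
    then show ?thesis using \<beta> by (auto simp: lookup_add)
  qed (use v in blast)
qed

lemma prime_ideal_contains_var_ideal:
  fixes Q :: "('v::finite, 'k::field) mpoly set"
  assumes Q: "prime_ideal Q" "ideal_gen (monomial_poly ` E) \<subseteq> Q"
  obtains A where "A \<in> covers E" "var_ideal A \<subseteq> Q"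
proof
  let ?A = "{v. monomial_poly (single v 1) \<in> Q}"
  have "monomial_poly \<epsilon> \<in> Q" if "\<epsilon> \<in> E" for \<epsilon>
    using Q(2) that ideal_gen_superset by blast
  then show "?A \<in> covers E" using prime_ideal_monomial[OF Q(1)] by (fastforce simp: covers_def)
  show "var_ideal ?A \<subseteq> Q"
    unfolding var_ideal_def using Q(1) by (auto simp: prime_ideal_def ideal_gen_subset_iff var_exps_def)
qed

lemma minimal_primes_monomial_ideal:
  fixes E :: "('v::finite \<Rightarrow>\<^sub>0 nat) set"
  shows "minimal_primes (ideal_gen (monomial_poly ` E) :: ('v, 'k::field) mpoly set)
    \<subseteq> var_ideal ` covers E"
proof
  fix P :: "('v, 'k) mpoly set" assume P: "P \<in> minimal_primes (ideal_gen (monomial_poly ` E))"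
  then obtain A where A: "A \<in> covers E" "var_ideal A \<subseteq> P"
    using prime_ideal_contains_var_ideal[of P E] by (auto simp: minimal_primes_def)
  then have "ideal_gen (monomial_poly ` E) \<subseteq> (var_ideal A :: ('v, 'k) mpoly set)"
    by (simp add: subset_var_ideal_iff)
  then have "var_ideal A = P"
    using P A(2) prime_ideal_var_ideal[of A] by (auto simp: minimal_primes_def)
  then show "P \<in> var_ideal ` covers E" using A(1) by blast
qed

text \<open>As there are finitely many sets of variables, \<open>A\<close> contains a minimal cover
  \<open>B\<close>. A prime between the monomial ideal and \<open>var_ideal B\<close> contains
  \<open>var_ideal C\<close> for some cover \<open>C\<close>, and \<open>C \<subseteq> B\<close>
  forces equality.\<close>

lemma minimal_prime_below_cover:
  fixes E :: "('v::finite \<Rightarrow>\<^sub>0 nat) set"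
  assumes "A \<in> covers E"
  obtains B where "B \<subseteq> A"
    "var_ideal B \<in> minimal_primes (ideal_gen (monomial_poly ` E) :: ('v, 'k::field) mpoly set)"
proof -
  have "finite (covers E)" by (rule finite_subset[of _ UNIV]) auto
  then obtain B where B: "B \<in> covers E" "B \<subseteq> A" and "\<forall>C\<in>covers E. C \<subseteq> B \<longrightarrow> B = C"
    using finite_has_minimal2[OF _ assms] by blast
  then have min: "C = B" if "C \<in> covers E" "C \<subseteq> B" for C
    using that by metis
  have "Q = var_ideal B"
    if Q: "prime_ideal Q" "ideal_gen (monomial_poly ` E) \<subseteq> Q" "Q \<subseteq> var_ideal B"
    for Q :: "('v, 'k) mpoly set"
  proof -
    obtain C where C: "C \<in> covers E" "var_ideal C \<subseteq> Q"
      using prime_ideal_contains_var_ideal[OF Q(1,2)] by blast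
    have "(var_ideal C :: ('v, 'k) mpoly set) \<subseteq> var_ideal B" using C(2) Q(3) by (rule order_trans)
    then have "C \<subseteq> B" by (simp only: var_ideal_subset_iff)
    then have "C = B" using min C(1) by blast
    then show ?thesis using C(2) Q(3) by auto
  qed
  then have "var_ideal B \<in> minimal_primes (ideal_gen (monomial_poly ` E) :: ('v, 'k) mpoly set)"
    using B(1) by (auto simp: minimal_primes_def prime_ideal_var_ideal subset_var_ideal_iff)
  then show ?thesis using that B(2) by blast
qed

text \<open>An exponent \<open>\<alpha>\<close> outside both \<open>frob_pow J q\<close> and
  \<open>I\<close> avoids some minimal prime as well, namely one generated by variables that do not
  occur in \<open>\<alpha>\<close>.\<close>

lemma frob_pow_sum_squarefree_eq_Inter:
  fixes D E :: "('v::finite \<Rightarrow>\<^sub>0 nat) set"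
  assumes pq: "prime CHAR('k::field)" "q = CHAR('k::field) ^ e"
    and E: "\<And>\<epsilon> v. \<epsilon> \<in> E \<Longrightarrow> lookup \<epsilon> v \<le> 1"
  defines "I \<equiv> (ideal_gen (monomial_poly ` E) :: ('v, 'k::field) mpoly set)"
    and "J \<equiv> (ideal_gen (monomial_poly ` D) :: ('v, 'k::field) mpoly set)"
  shows "ideal_gen (frob_pow J q \<union> I) = (\<Inter>P\<in>minimal_primes I. ideal_gen (frob_pow J q \<union> P))"
proof
  show "ideal_gen (frob_pow J q \<union> I) \<subseteq> (\<Inter>P\<in>minimal_primes I. ideal_gen (frob_pow J q \<union> P))"
    by (intro INF_greatest ideal_gen_mono) (auto simp: minimal_primes_def)
  show "(\<Inter>P\<in>minimal_primes I. ideal_gen (frob_pow J q \<union> P)) \<subseteq> ideal_gen (frob_pow J q \<union> I)"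
  proof
    fix f assume f: "f \<in> (\<Inter>P\<in>minimal_primes I. ideal_gen (frob_pow J q \<union> P))"
    have "keys f \<subseteq> exps_above (exp_scale q ` D) \<union> exps_above E"
    proof (rule subsetI, rule ccontr)
      fix \<alpha> assume \<alpha>: "\<alpha> \<in> keys f" "\<alpha> \<notin> exps_above (exp_scale q ` D) \<union> exps_above E"
      have "{v. lookup \<alpha> v = 0} \<in> covers E"
      proof (rule ccontr)
        assume "\<not> ?thesis"
        then obtain \<epsilon> where \<epsilon>: "\<epsilon> \<in> E" "\<forall>v. lookup \<alpha> v > 0 \<or> lookup \<epsilon> v = 0"
          by (auto simp: covers_def)
        \<comment> \<open>Squarefreeness enters here: \<open>\<epsilon>\<close> divides
          \<open>\<alpha>\<close> as soon as its support lies in that of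
          \<open>\<alpha>\<close>.\<close>
        have "lookup \<epsilon> v \<le> lookup \<alpha> v" for v
          using E[OF \<epsilon>(1), of v] spec[OF \<epsilon>(2), of v] by linarith
        then show False using \<alpha>(2) \<epsilon>(1) by (auto simp: exps_above_iff)
      qed
      then obtain B where B: "B \<subseteq> {v. lookup \<alpha> v = 0}" "var_ideal B \<in> minimal_primes I"
        unfolding I_def by (rule minimal_prime_below_cover)
      then have "f \<in> ideal_gen (frob_pow J q \<union> var_ideal B)" using f by blast
      then have "\<alpha> \<in> exps_above (exp_scale q ` D) \<union> exps_above (var_exps B)"
        unfolding J_def var_ideal_def mem_frob_pow_sum_monomial_iff[OF pq] using \<alpha>(1) by blast
      then show False using \<alpha>(2) B(1) by (auto simp: exps_above_var_exps)
    qed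
    then show "f \<in> ideal_gen (frob_pow J q \<union> I)"
      unfolding J_def I_def mem_frob_pow_sum_monomial_iff[OF pq] .
  qed
qed

section \<open>Thresholds of the quotient\<close>

text \<open>Modulo \<open>var_ideal A\<close> only exponents vanishing on \<open>A\<close> count,
  and only generators of the monomial ideal without variables from \<open>A\<close> can lie below
  such an exponent.\<close>

lemma mem_frob_pow_sum_var_ideal_iff:
  fixes D :: "('v::finite \<Rightarrow>\<^sub>0 nat) set" and f :: "('v, 'k::field) mpoly"
  assumes pq: "prime CHAR('k)" "q = CHAR('k) ^ e"
  shows "f \<in> ideal_gen (frob_pow (ideal_gen (monomial_poly ` D)) q \<union> var_ideal A) \<longleftrightarrow>
    kill_vars A f \<in> frob_pow (ideal_gen (monomial_poly ` {\<delta>\<in>D. \<forall>v\<in>A. lookup \<delta> v = 0})) q"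
proof -
  have q: "q > 0" using pq by (simp add: prime_gt_0_nat)
  have *: "\<alpha> \<in> exps_above (exp_scale q ` D) \<longleftrightarrow>
      \<alpha> \<in> exps_above (exp_scale q ` {\<delta>\<in>D. \<forall>v\<in>A. lookup \<delta> v = 0})"
    if \<alpha>: "\<forall>v\<in>A. lookup \<alpha> v = 0" for \<alpha>
  proof
    assume "\<alpha> \<in> exps_above (exp_scale q ` D)"
    then obtain \<delta> where \<delta>: "\<delta> \<in> D" "\<And>v. q * lookup \<delta> v \<le> lookup \<alpha> v"
      by (auto simp: exps_above_iff)
    have "lookup \<delta> v = 0" if "v \<in> A" for v
      using \<delta>(2)[of v] \<alpha> that q by simp
    then show "\<alpha> \<in> exps_above (exp_scale q ` {\<delta>\<in>D. \<forall>v\<in>A. lookup \<delta> v = 0})"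
      using \<delta> by (auto simp: exps_above_iff)
  qed (auto simp: exps_above_iff)
  have "f \<in> ideal_gen (frob_pow (ideal_gen (monomial_poly ` D)) q \<union> var_ideal A) \<longleftrightarrow>
      keys f \<subseteq> exps_above (exp_scale q ` D) \<union> {\<alpha>. \<exists>v\<in>A. lookup \<alpha> v > 0}"
    unfolding var_ideal_def mem_frob_pow_sum_monomial_iff[OF pq] exps_above_var_exps by (rule refl)
  then show ?thesis
    using * by (auto simp: frob_pow_monomial_ideal[OF pq] mem_monomial_ideal_iff keys_kill_vars)
qed

text \<open>Under \<open>kill_vars A\<close> the ideals become \<open>ideal_gen F'\<close> and
  \<open>J'\<close>, and the two functions \<open>nu_quot\<close> and \<open>T.nu\<close> agree;
  existence and rationality of the limit then come from the locale.\<close>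

lemma threshold_var_ideal:
  fixes a :: "('v::finite, 'k::field) mpoly set" and D :: "('v \<Rightarrow>\<^sub>0 nat) set"
  assumes p: "prime p" "CHAR('k) = p" and a: "is_ideal a"
    and J: "J = ideal_gen (monomial_poly ` D)" and rad: "a \<subseteq> ideal_radical J"
  shows "F_threshold_quot p (var_ideal A) a J \<in> \<rat>"
    and "(\<lambda>e. real (nu_quot (var_ideal A) a J (p ^ e)) / real (p ^ e))
      \<longlonglongrightarrow> F_threshold_quot p (var_ideal A) a J"
    and "finite {m. \<not> ideal_pow a m \<subseteq> ideal_gen (frob_pow J (p ^ e) \<union> var_ideal A)}"
proof -
  obtain F where F: "finite F" "a = ideal_gen F" using hilbert_basis[OF a] by blast
  define F' where "F' = kill_vars A ` F"
  define J' where "J' = (ideal_gen (monomial_poly ` {\<delta>\<in>D. \<forall>v\<in>A. lookup \<delta> v = 0}) :: ('v, 'k) mpoly set)"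
  interpret T: frobenius_thresholds F' p
    by unfold_locales (use p F in \<open>simp_all add: F'_def\<close>)
  note hom = kill_vars_mult[of A] kill_vars_0[of A] kill_vars_1[of A] kill_vars_add[of A]
  have gens: "ideal_gen (kill_vars A ` a) = ideal_gen F'"
  proof
    have "ideal_gen F \<subseteq> {x. kill_vars A x \<in> ideal_gen F'}"
      by (subst ideal_gen_subset_iff)
         (auto intro!: is_ideal_vimage simp: hom F'_def intro: ideal_gen_base)
    then show "ideal_gen (kill_vars A ` a) \<subseteq> ideal_gen F'"
      unfolding F(2) by (intro ideal_gen_subset_ideal_genI) blast
    show "ideal_gen F' \<subseteq> ideal_gen (kill_vars A ` a)"
      unfolding F'_def F(2) by (intro ideal_gen_mono image_mono ideal_gen_superset)
  qed
  have kill_J: "kill_vars A f \<in> J'" if "f \<in> J" for f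
    unfolding J'_def mem_monomial_ideal_iff
  proof
    fix \<alpha> assume "\<alpha> \<in> keys (kill_vars A f)"
    then have \<alpha>: "\<alpha> \<in> keys f" "\<forall>v\<in>A. lookup \<alpha> v = 0" by (auto simp: keys_kill_vars)
    have "\<alpha> \<in> exps_above D"
      using that \<alpha>(1) unfolding J mem_monomial_ideal_iff by blast
    then obtain \<delta> where \<delta>: "\<delta> \<in> D" "\<forall>v. lookup \<delta> v \<le> lookup \<alpha> v"
      unfolding exps_above_iff by blast
    then have "\<forall>v\<in>A. lookup \<delta> v = 0" using \<alpha>(2) by (metis le_zero_eq)
    then show "\<alpha> \<in> exps_above {\<delta>\<in>D. \<forall>v\<in>A. lookup \<delta> v = 0}"
      using \<delta> unfolding exps_above_iff by blast
  qed
  have adm: "T.admissible J'"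
    unfolding T.admissible_def
  proof (intro conjI ballI)
    show "is_ideal J'" by (simp add: J'_def)
    fix g assume "g \<in> F'"
    then obtain f where f: "g = kill_vars A f" "f \<in> a"
      using ideal_gen_superset F(2) by (auto simp: F'_def)
    then obtain n where "f ^ n \<in> J" using rad by (auto simp: ideal_radical_def)
    then show "\<exists>n. g ^ n \<in> J'" using kill_J f(1) by (metis kill_vars_power)
  qed
  have sub: "ideal_pow a m \<subseteq> ideal_gen (frob_pow J (p ^ e) \<union> var_ideal A)
      \<longleftrightarrow> ideal_pow (ideal_gen F') m \<subseteq> frob_pow J' (p ^ e)" for m e
  proof -
    have "ideal_pow a m \<subseteq> ideal_gen (frob_pow J (p ^ e) \<union> var_ideal A)
        \<longleftrightarrow> kill_vars A ` ideal_pow a m \<subseteq> frob_pow J' (p ^ e)"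
      unfolding J J'_def subset_iff mem_frob_pow_sum_var_ideal_iff[OF T.char_facts(1,2)] by auto
    also have "\<dots> \<longleftrightarrow> ideal_gen (kill_vars A ` ideal_pow a m) \<subseteq> frob_pow J' (p ^ e)"
      by (simp add: ideal_gen_subset_iff)
    also have "ideal_gen (kill_vars A ` ideal_pow a m) = ideal_pow (ideal_gen F') m"
      unfolding gens[symmetric] by (rule ideal_pow_image_ideal_gen[symmetric]) (rule hom)+
    finally show ?thesis .
  qed
  then show "finite {m. \<not> ideal_pow a m \<subseteq> ideal_gen (frob_pow J (p ^ e) \<union> var_ideal A)}"
    using T.finite_nu_set[OF adm] by simp
  have nu: "nu_quot (var_ideal A) a J (p ^ e) = T.nu J' (p ^ e)" for e
    by (simp add: nu_quot_def T.nu_def sub)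
  have thr: "F_threshold_quot p (var_ideal A) a J = T.thr J'"
    unfolding F_threshold_quot_def T.thr_def nu by (rule refl)
  show "F_threshold_quot p (var_ideal A) a J \<in> \<rat>"
    unfolding thr by (rule T.thr_rational[OF adm])
  show "(\<lambda>e. real (nu_quot (var_ideal A) a J (p ^ e)) / real (p ^ e))
      \<longlonglongrightarrow> F_threshold_quot p (var_ideal A) a J"
    unfolding thr nu by (rule T.thr_tendsto[OF adm])
qed

section \<open>Suprema and limits of finite maxima\<close>

lemma Sup_UN_nat:
  fixes X :: "'i \<Rightarrow> nat set"
  assumes "finite S" "S \<noteq> {}" "\<And>i. i \<in> S \<Longrightarrow> finite (X i)"
  shows "Sup (\<Union>i\<in>S. X i) = Max ((\<lambda>i. Sup (X i)) ` S)"
proof (rule antisym)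
  have le: "Sup (X i) \<le> Max ((\<lambda>i. Sup (X i)) ` S)" if "i \<in> S" for i
    using assms that by auto
  have "x \<le> Max ((\<lambda>i. Sup (X i)) ` S)" if x: "x \<in> (\<Union>i\<in>S. X i)" for x
  proof -
    obtain i where i: "i \<in> S" "x \<in> X i" using x by blast
    then have "x \<le> Sup (X i)" using assms(3) by (intro cSup_upper) auto
    with le[OF i(1)] show ?thesis by simp
  qed
  \<comment> \<open>An empty set has supremum 0, the least natural number, so it does not disturb
    the maximum.\<close>
  then show "Sup (\<Union>i\<in>S. X i) \<le> Max ((\<lambda>i. Sup (X i)) ` S)"
    by (cases "(\<Union>i\<in>S. X i) = {}") (auto simp: Sup_nat_def[of "{}"] intro!: cSup_least)
  have "finite (\<Union>i\<in>S. X i)" using assms by blast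
  then have "Sup (X i) \<le> Sup (\<Union>i\<in>S. X i)" if "i \<in> S" for i
    using that by (cases "X i = {}") (auto simp: Sup_nat_def[of "{}"] intro!: cSup_subset_mono)
  then show "Max ((\<lambda>i. Sup (X i)) ` S) \<le> Sup (\<Union>i\<in>S. X i)"
    using assms by auto
qed

lemma tendsto_Max_image:
  fixes f :: "'i \<Rightarrow> nat \<Rightarrow> real"
  assumes "finite S" "S \<noteq> {}" "\<And>i. i \<in> S \<Longrightarrow> f i \<longlonglongrightarrow> c i"
  shows "(\<lambda>n. Max ((\<lambda>i. f i n) ` S)) \<longlonglongrightarrow> Max (c ` S)"
  using assms
proof (induction S rule: finite_ne_induct)
  case (insert i S)
  then show ?case by (auto intro!: tendsto_max)
qed simp

theorem theoremB:
  fixes I \<aa> J :: "(('v::finite \<Rightarrow>\<^sub>0 nat) \<Rightarrow>\<^sub>0 'k::field) set"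
    and p :: nat
  assumes "prime p" and "CHAR('k) = p" and "F_finite TYPE('k)"
    and "squarefree_monomial_ideal I" and "I \<noteq> UNIV"
    and "is_ideal \<aa>" and "I \<subseteq> \<aa>"
    and "\<exists>G. G \<subseteq> range monomial_poly \<and> J = ideal_gen (G \<union> I)"
    and "\<aa> \<subseteq> ideal_radical J"
  shows "F_threshold_quot p I \<aa> J = Max ((\<lambda>P. F_threshold_quot p P \<aa> J) ` minimal_primes I)
       \<and> F_threshold_quot p I \<aa> J \<in> \<rat>"
proof -
  obtain E :: "('v \<Rightarrow>\<^sub>0 nat) set" where E: "\<And>\<epsilon> v. \<epsilon> \<in> E \<Longrightarrow> lookup \<epsilon> v \<le> 1"
    and I: "I = ideal_gen (monomial_poly ` E)"
    using assms(4) unfolding squarefree_monomial_ideal_def by (auto simp: subset_image_iff)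
  obtain D' :: "('v \<Rightarrow>\<^sub>0 nat) set" where "J = ideal_gen (monomial_poly ` D' \<union> I)"
    using assms(8) by (auto simp: subset_image_iff)
  \<comment> \<open>\<open>J\<close> is the preimage of a monomial ideal of the quotient; as
    \<open>I\<close> has monomial generators too, this preimage is a monomial ideal of the
    polynomial ring.\<close>
  then have J: "J = ideal_gen (monomial_poly ` (D' \<union> E))"
    by (simp add: I ideal_gen_Un_ideal_gen image_Un)
  have pq: "prime CHAR('k)" "p ^ e = CHAR('k) ^ e" for e using assms(1,2) by auto
  let ?M = "minimal_primes I" and ?c = "\<lambda>P. F_threshold_quot p P \<aa> J"
  have M_var: "\<exists>A. P = var_ideal A" if "P \<in> ?M" for P
    using minimal_primes_monomial_ideal[of E] that unfolding I by blast
  have "?M \<subseteq> range var_ideal" using M_var by blast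
  then have finM: "finite ?M" by (rule finite_subset) simp
  \<comment> \<open>Properness of \<open>I\<close> makes the set of all variables a cover, hence
    yields a minimal prime, so the maximum ranges over a nonempty set.\<close>
  have "0 \<notin> E"
  proof
    assume "0 \<in> E"
    then have "1 \<in> I" unfolding I monomial_poly_def by (force intro: ideal_gen_base)
    then have "x \<in> I" for x using ideal_mult_left[of I 1 x] by (simp add: I)
    with assms(5) show False by blast
  qed
  then have "\<exists>v. lookup \<epsilon> v > 0" if "\<epsilon> \<in> E" for \<epsilon>
    using that by (metis gr0I lookup_zero poly_mapping_eqI)
  then have "UNIV \<in> covers E" by (simp add: covers_def)
  then have M_ne: "?M \<noteq> {}" unfolding I by (metis empty_iff minimal_prime_below_cover)
  note thr = threshold_var_ideal[OF assms(1,2,6) J assms(9)]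
  have nu: "nu_quot I \<aa> J (p ^ e) = Max ((\<lambda>P. nu_quot P \<aa> J (p ^ e)) ` ?M)" for e
  proof -
    have "ideal_gen (frob_pow J (p ^ e) \<union> I) = (\<Inter>P\<in>?M. ideal_gen (frob_pow J (p ^ e) \<union> P))"
      unfolding I J by (rule frob_pow_sum_squarefree_eq_Inter[OF pq E])
    \<comment> \<open>Failing to lie in an intersection means failing to lie in some member, so the
      exponents in question form a union and their supremum is a maximum.\<close>
    then have "{m. \<not> ideal_pow \<aa> m \<subseteq> ideal_gen (frob_pow J (p ^ e) \<union> I)}
        = (\<Union>P\<in>?M. {m. \<not> ideal_pow \<aa> m \<subseteq> ideal_gen (frob_pow J (p ^ e) \<union> P)})"
      by auto
    moreover have "finite {m. \<not> ideal_pow \<aa> m \<subseteq> ideal_gen (frob_pow J (p ^ e) \<union> P)}"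
      if "P \<in> ?M" for P
      using M_var[OF that] thr(3) by auto
    ultimately show ?thesis
      unfolding nu_quot_def by (simp only: Sup_UN_nat[OF finM M_ne])
  qed
  have "real (nu_quot I \<aa> J (p ^ e)) / real (p ^ e)
      = Max ((\<lambda>P. real (nu_quot P \<aa> J (p ^ e)) / real (p ^ e)) ` ?M)" for e
  proof -
    have "mono (\<lambda>n. real n / real (p ^ e))" by (intro monoI divide_right_mono) auto
    from mono_Max_commute[OF this, of "(\<lambda>P. nu_quot P \<aa> J (p ^ e)) ` ?M"]
    show ?thesis unfolding nu image_image using finM M_ne by simp
  qed
  moreover have "(\<lambda>e. Max ((\<lambda>P. real (nu_quot P \<aa> J (p ^ e)) / real (p ^ e)) ` ?M)) \<longlonglongrightarrow> Max (?c ` ?M)"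
    using thr(2) M_var by (intro tendsto_Max_image finM M_ne) blast
  ultimately have "(\<lambda>e. real (nu_quot I \<aa> J (p ^ e)) / real (p ^ e)) \<longlonglongrightarrow> Max (?c ` ?M)"
    by simp
  then have eq: "F_threshold_quot p I \<aa> J = Max (?c ` ?M)"
    unfolding F_threshold_quot_def[of p I] by (rule limI)
  \<comment> \<open>The maximum is attained at some minimal prime and inherits rationality from that
    component.\<close>
  have "Max (?c ` ?M) \<in> ?c ` ?M" using finM M_ne by (intro Max_in) auto
  then have "Max (?c ` ?M) \<in> \<rat>" using thr(1) M_var by (metis (no_types, lifting) imageE)
  with eq show ?thesis by simp
qed

end
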